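(* Let $H\in(1/2,1)$, let $(B^H_t)_{t\ge0}$ be a fractional Brownian motion with Hurst parameter $H$, let $x_0>0$ and let $K>0$ be a constant. Let $(X_t,t\ge0)$ be the unique positive solution to the equation $$X_t=x_0+\int_0^t\frac{K}{X_s}\,ds+B^H_t,\qquad t\ge0.$$ Then, for all $p\ge1$ and all $0\le t\le\left(\frac{K}{(p+1)H}\right)^{\frac{1}{2H-1}}$, we have $$\mathbb{E}(X_t^{-p})\le x_0^{-p}.$$
   Context: A fractional Brownian motion with Hurst parameter $H$ is a mean zero Gaussian process $(B^H_t)_{t\ge0}$ with continuous paths and covariance $\mathbb{E}(B^H_tB^H_s)=\frac12\left(t^{2H}+s^{2H}-|t-s|^{2H}\right)$. The equation has a unique pathwise solution which is almost surely strictly positive on $[0,\infty)$. *)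

theory Defs
  imports "HOL-Probability.Probability"
begin

text \<open>Gaussian laws are allowed to be degenerate (a point mass), since the density
  \<^const>\<open>normal_density\<close> only covers positive variance; for instance fractional
  Brownian motion vanishes almost surely at time 0.\<close>

definition gaussian_variable :: "'a measure \<Rightarrow> ('a \<Rightarrow> real) \<Rightarrow> bool" where
  "gaussian_variable M Y \<longleftrightarrow>
     Y \<in> borel_measurable M \<and>
     ((\<exists>\<mu>. AE \<omega> in M. Y \<omega> = \<mu>) \<or>
      (\<exists>\<mu> \<sigma>. \<sigma> > 0 \<and> distributed M lborel Y (\<lambda>x. ennreal (normal_density \<mu> \<sigma> x))))"

definition gaussian_process ::
    "'a measure \<Rightarrow> 'i set \<Rightarrow> ('i \<Rightarrow> 'a \<Rightarrow> real) \<Rightarrow> bool" where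
  "gaussian_process M T B \<longleftrightarrow>
     (\<forall>I c. finite I \<and> I \<subseteq> T \<longrightarrow> gaussian_variable M (\<lambda>\<omega>. \<Sum>i\<in>I. c i * B i \<omega>))"

text \<open>Processes are functions on all of the reals, but only times \<open>t \<ge> 0\<close> matter.\<close>

definition fractional_brownian_motion ::
    "'a measure \<Rightarrow> real \<Rightarrow> (real \<Rightarrow> 'a \<Rightarrow> real) \<Rightarrow> bool" where
  "fractional_brownian_motion M H B \<longleftrightarrow>
     gaussian_process M {0..} B \<and>
     (\<forall>t\<ge>0. (\<integral>\<omega>. B t \<omega> \<partial>M) = 0) \<and>
     (\<forall>s\<ge>0. \<forall>t\<ge>0. (\<integral>\<omega>. B t \<omega> * B s \<omega> \<partial>M)
        = (t powr (2 * H) + s powr (2 * H) - \<bar>t - s\<bar> powr (2 * H)) / 2) \<and>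
     (AE \<omega> in M. continuous_on {0..} (\<lambda>t. B t \<omega>))"

text \<open>Integrability of the drift is required explicitly because the Lebesgue integral of a
  non-integrable function is 0 by convention. Continuity of the paths of \<open>X\<close> then
  follows from the equation.\<close>

definition positive_solution ::
    "'a measure \<Rightarrow> (real \<Rightarrow> 'a \<Rightarrow> real) \<Rightarrow> real \<Rightarrow> real \<Rightarrow> (real \<Rightarrow> 'a \<Rightarrow> real) \<Rightarrow> bool" where
  "positive_solution M B K x0 X \<longleftrightarrow>
     (\<forall>t\<ge>0. X t \<in> borel_measurable M) \<and>
     (AE \<omega> in M. \<forall>t\<ge>0. X t \<omega> > 0 \<and>
        set_integrable lborel {0..t} (\<lambda>s. K / X s \<omega>) \<and>
        X t \<omega> = x0 + (LBINT s:{0..t}. K / X s \<omega>) + B t \<omega>)"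

end

theory Submission
  imports Defs
begin

text \<open>Discretise time with step \<open>h\<close> and use the implicit Euler scheme
  \<open>Y' = Y + \<eta> + c / Y'\<close>, where \<open>\<eta>\<close> is the increment of the noise and \<open>c\<close> is close to
  \<open>K * h\<close>. Convexity of \<open>f x = (x + \<epsilon>) powr (- p)\<close> gives, without any error term,
  \<open>f Y' - f Y \<le> - p * (Y' + \<epsilon>) powr (- p - 1) * \<eta> - p * c * (Y' + \<epsilon>) powr (- p - 2)\<close>;
  the shift by \<open>\<epsilon> > 0\<close> keeps all these quantities bounded. By Gaussian integration by parts
  the expectation of the first term is at most \<open>p * (p + 1) * S\<close> times that of
  \<open>(Y' + \<epsilon>) powr (- p - 2)\<close>, where \<open>S\<close> is the sum of the covariances of \<open>\<eta>\<close> with the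
  increments up to and including \<open>\<eta>\<close> itself: these are nonnegative since \<open>H > 1/2\<close>, and each
  step of the scheme is nondecreasing and nonexpansive. Up to the critical time
  \<open>(p + 1) * S \<le> c\<close>, so the expectation of \<open>f\<close> decreases along the scheme. The scheme
  converges pathwise because \<open>x \<mapsto> K / x\<close> is decreasing, and Fatou's lemma concludes.\<close>

section \<open>Independence from characteristic functions\<close>

text \<open>In continuous time the noise term of a change of variables for
  \<open>X t powr (- p)\<close> is a pathwise integral with nonzero mean, and computing that mean
  calls for control of negative moments of \<open>X\<close>, the very thing to be bounded. On a grid
  only finitely many Gaussian increments occur and every expectation is finite. Implicitness serves
  twice: \<open>Y'\<close> is positive whatever the noise, and the tangent of \<open>f\<close> at
  \<open>Y'\<close> lies below the graph, so no second-order term appears. The price is that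
  \<open>Y'\<close> depends on \<open>\<eta>\<close> itself, so \<open>S\<close> includes the
  variance of \<open>\<eta>\<close>. The critical time is read off from \<open>S\<close>. The
  covariances telescope to that of \<open>B s\<close> with \<open>B s - B (s - h)\<close>, at most
  \<open>H * s powr (2 * H - 1) * h + h powr (2 * H) / 2\<close>. As \<open>2 * H > 1\<close>, the
  last term is of smaller order than \<open>h\<close>, and to leading order
  \<open>(p + 1) * S \<le> K * h\<close> says
  \<open>s powr (2 * H - 1) \<le> K / ((p + 1) * H)\<close>. The Gaussian vectors may be degenerate,
  so no joint density is used: integration by parts regresses on a single increment, and the step
  from uncorrelated to independent is what the section on characteristic functions supplies.\<close>

text \<open>The signed measure with density \<open>U\<close>, pushed forward by \<open>Z\<close>,
  has zero Fourier transform. Its positive and negative parts, once normalised, are probability laws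
  with equal characteristic functions, hence equal by Levy's uniqueness theorem.\<close>

lemma integral_iexp_eq_0_real:
  fixes U :: "'a \<Rightarrow> real"
  assumes U: "integrable M U" and Z [measurable]: "Z \<in> borel_measurable M"
    and zero: "\<And>s. (CLINT \<omega>|M. of_real (U \<omega>) * iexp (s * Z \<omega>)) = 0"
    and A [measurable]: "A \<in> sets borel"
  shows "(\<integral>\<omega>. U \<omega> * indicator A (Z \<omega>) \<partial>M) = 0"
proof -
  have [measurable]: "U \<in> borel_measurable M" using U by auto
  define P where "P \<omega> = max 0 (U \<omega>)" for \<omega>
  define N where "N \<omega> = max 0 (- U \<omega>)" for \<omega>
  have [measurable]: "P \<in> borel_measurable M" "N \<in> borel_measurable M"
    unfolding P_def N_def by measurable
  have nonneg: "0 \<le> P \<omega>" "0 \<le> N \<omega>" for \<omega> by (auto simp: P_def N_def)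
  have UPN: "U \<omega> = P \<omega> - N \<omega>" for \<omega> by (auto simp: P_def N_def)
  have intP: "integrable M P" and intN: "integrable M N"
    unfolding P_def N_def using U by auto
  have bdd: "integrable M (\<lambda>\<omega>. complex_of_real (V \<omega>) * iexp (s * Z \<omega>))"
    if "integrable M V" for V :: "'a \<Rightarrow> real" and s
  proof (rule Bochner_Integration.integrable_bound[OF that])
    from that have [measurable]: "V \<in> borel_measurable M" by auto
    show "(\<lambda>\<omega>. complex_of_real (V \<omega>) * iexp (s * Z \<omega>)) \<in> borel_measurable M" by measurable
  qed (auto simp: norm_mult)
  have char_eq: "(CLINT \<omega>|M. of_real (P \<omega>) * iexp (s * Z \<omega>)) = (CLINT \<omega>|M. of_real (N \<omega>) * iexp (s * Z \<omega>))" for s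
  proof -
    have "0 = (CLINT \<omega>|M. of_real (P \<omega>) * iexp (s * Z \<omega>) - of_real (N \<omega>) * iexp (s * Z \<omega>))"
      using zero[of s] by (simp add: UPN algebra_simps)
    also have "\<dots> = (CLINT \<omega>|M. of_real (P \<omega>) * iexp (s * Z \<omega>)) - (CLINT \<omega>|M. of_real (N \<omega>) * iexp (s * Z \<omega>))"
      by (rule Bochner_Integration.integral_diff) (intro bdd intP intN)+
    finally show ?thesis by simp
  qed
  define m where "m = (\<integral>\<omega>. P \<omega> \<partial>M)"
  \<comment> \<open>At frequency 0 the transforms are the total masses, so a single constant
    \<open>m\<close> normalises both parts.\<close>
  have "complex_of_real (\<integral>\<omega>. P \<omega> \<partial>M) = complex_of_real (\<integral>\<omega>. N \<omega> \<partial>M)"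
    using char_eq[of 0] by simp
  hence mN: "m = (\<integral>\<omega>. N \<omega> \<partial>M)" unfolding m_def by (simp only: of_real_eq_iff)
  have m0: "m \<ge> 0" unfolding m_def using nonneg by simp
  show ?thesis
  proof (cases "m = 0")
    case True
    have "AE \<omega> in M. P \<omega> = 0" "AE \<omega> in M. N \<omega> = 0"
      using True mN integral_nonneg_eq_0_iff_AE[OF intP] integral_nonneg_eq_0_iff_AE[OF intN] nonneg
      by (auto simp: m_def)
    hence "AE \<omega> in M. U \<omega> * indicator A (Z \<omega>) = 0" by eventually_elim (simp add: UPN)
    thus ?thesis by (simp cong: integral_cong_AE add: integral_eq_zero_AE)
  next
    case False
    with m0 have m: "m > 0" by simp
    define D where "D V = distr (density M (\<lambda>\<omega>. ennreal (V \<omega> / m))) borel Z" for V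
    have rd: "real_distribution (D V)"
      if V: "integrable M V" "(\<integral>\<omega>. V \<omega> \<partial>M) = m" "\<And>\<omega>. 0 \<le> V \<omega>" for V
    proof -
      have [measurable]: "V \<in> borel_measurable M" using V by auto
      have "emeasure (density M (\<lambda>\<omega>. ennreal (V \<omega> / m))) (space M) = (\<integral>\<^sup>+\<omega>. ennreal (V \<omega> / m) \<partial>M)"
        by (subst emeasure_density) (auto intro!: nn_integral_cong)
      also have "\<dots> = ennreal (\<integral>\<omega>. V \<omega> / m \<partial>M)"
        using V m by (intro nn_integral_eq_integral) auto
      also have "\<dots> = 1" using V m by simp
      finally have "prob_space (density M (\<lambda>\<omega>. ennreal (V \<omega> / m)))"
        by (intro prob_spaceI) simp
      then interpret prob_space "density M (\<lambda>\<omega>. ennreal (V \<omega> / m))" .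
      show ?thesis unfolding D_def
        by (rule real_distribution_distr) simp
    qed
    have int_D: "(\<integral>x. f x \<partial>D V) = (\<integral>\<omega>. V \<omega> *\<^sub>R f (Z \<omega>) \<partial>M) /\<^sub>R m"
      if V: "integrable M V" "\<And>\<omega>. 0 \<le> V \<omega>" and f[measurable]: "f \<in> borel_measurable borel"
      for V :: "'a \<Rightarrow> real" and f :: "real \<Rightarrow> 'b::{banach, second_countable_topology}"
    proof -
      have [measurable]: "V \<in> borel_measurable M" using V by auto
      have "(\<integral>x. f x \<partial>D V) = (\<integral>\<omega>. (V \<omega> / m) *\<^sub>R f (Z \<omega>) \<partial>M)"
        unfolding D_def using V m by (subst integral_distr) (auto simp: integral_density)
      also have "\<dots> = (\<integral>\<omega>. inverse m *\<^sub>R (V \<omega> *\<^sub>R f (Z \<omega>)) \<partial>M)"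
        by (simp add: field_simps)
      finally show ?thesis by (simp only: integral_scaleR_right)
    qed
    have "char (D P) = char (D N)"
      unfolding char_def
      using char_eq by (simp add: int_D intP intN nonneg scaleR_conv_of_real)
    hence "D P = D N"
      by (intro Levy_uniqueness rd) (auto simp: intP intN nonneg simp flip: mN m_def)
    hence "(\<integral>x. indicator A x \<partial>D P) = (\<integral>x. indicator A x \<partial>D N :: real)" by simp
    hence eq: "(\<integral>\<omega>. P \<omega> * indicator A (Z \<omega>) \<partial>M) = (\<integral>\<omega>. N \<omega> * indicator A (Z \<omega>) \<partial>M)"
      using m
      unfolding int_D[OF intP nonneg(1) borel_measurable_indicator[OF A]]
        int_D[OF intN nonneg(2) borel_measurable_indicator[OF A]] by simp
    have int: "integrable M (\<lambda>\<omega>. V \<omega> * indicator A (Z \<omega>))" if "integrable M V" for V :: "'a \<Rightarrow> real"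
    proof (rule Bochner_Integration.integrable_bound[OF that])
      from that have [measurable]: "V \<in> borel_measurable M" by auto
      show "(\<lambda>\<omega>. V \<omega> * indicator A (Z \<omega>)) \<in> borel_measurable M" by measurable
    qed (auto simp: indicator_def)
    have "(\<integral>\<omega>. U \<omega> * indicator A (Z \<omega>) \<partial>M)
        = (\<integral>\<omega>. P \<omega> * indicator A (Z \<omega>) - N \<omega> * indicator A (Z \<omega>) \<partial>M)"
      by (simp add: UPN algebra_simps)
    also have "\<dots> = 0"
      using eq by (simp add: Bochner_Integration.integral_diff int intP intN)
    finally show ?thesis .
  qed
qed

text \<open>Conjugation turns the frequency \<open>s\<close> into \<open>- s\<close>, so
  \<open>cnj U\<close> satisfies the same hypothesis, and with it the real and imaginary parts of
  \<open>U\<close>. The complex version is needed because \<open>U\<close> will itself contain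
  exponentials of other variables.\<close>

lemma integral_iexp_eq_0:
  fixes U :: "'a \<Rightarrow> complex"
  assumes U: "integrable M U" and Z [measurable]: "Z \<in> borel_measurable M"
    and zero: "\<And>s. (CLINT \<omega>|M. U \<omega> * iexp (s * Z \<omega>)) = 0"
    and A [measurable]: "A \<in> sets borel"
  shows "(CLINT \<omega>|M. U \<omega> * indicator A (Z \<omega>)) = 0"
proof -
  have [measurable]: "U \<in> borel_measurable M" using U by auto
  have int: "integrable M (\<lambda>\<omega>. V \<omega> * iexp (s * Z \<omega>))" if "integrable M V" for V s
  proof (rule Bochner_Integration.integrable_bound[OF that])
    from that have [measurable]: "V \<in> borel_measurable M" by auto
    show "(\<lambda>\<omega>. V \<omega> * iexp (s * Z \<omega>)) \<in> borel_measurable M" by measurable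
  qed (auto simp: norm_mult)
  have zero': "(CLINT \<omega>|M. cnj (U \<omega>) * iexp (s * Z \<omega>)) = 0" for s
  proof -
    have "(CLINT \<omega>|M. cnj (U \<omega>) * iexp (s * Z \<omega>)) = (CLINT \<omega>|M. cnj (U \<omega> * iexp ((-s) * Z \<omega>)))"
      by (simp add: exp_cnj)
    also have "\<dots> = cnj (CLINT \<omega>|M. U \<omega> * iexp ((-s) * Z \<omega>))"
      by (rule Bochner_Integration.integral_cnj)
    also have "\<dots> = 0" by (subst zero) simp
    finally show ?thesis .
  qed
  have re: "(\<integral>\<omega>. Re (U \<omega>) * indicator A (Z \<omega>) \<partial>M) = 0"
  proof (rule integral_iexp_eq_0_real[OF _ Z _ A])
    fix s
    have "(CLINT \<omega>|M. of_real (Re (U \<omega>)) * iexp (s * Z \<omega>))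
      = (CLINT \<omega>|M. (1/2) * (U \<omega> * iexp (s * Z \<omega>) + cnj (U \<omega>) * iexp (s * Z \<omega>)))"
      by (rule Bochner_Integration.integral_cong)
        (simp_all add: complex_add_cnj flip: distrib_right)
    also have "\<dots> = (1/2) * ((CLINT \<omega>|M. U \<omega> * iexp (s * Z \<omega>)) + (CLINT \<omega>|M. cnj (U \<omega>) * iexp (s * Z \<omega>)))"
      by (simp only: integral_mult_right_zero
          Bochner_Integration.integral_add[OF int[OF U] int[OF integrable_cnj[OF U]]])
    finally show "(CLINT \<omega>|M. of_real (Re (U \<omega>)) * iexp (s * Z \<omega>)) = 0"
      by (simp only: zero zero') simp
  qed (use U in auto)
  have im: "(\<integral>\<omega>. Im (U \<omega>) * indicator A (Z \<omega>) \<partial>M) = 0"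
  proof (rule integral_iexp_eq_0_real[OF _ Z _ A])
    fix s
    have "(CLINT \<omega>|M. of_real (Im (U \<omega>)) * iexp (s * Z \<omega>))
      = (CLINT \<omega>|M. (- \<i>/2) * (U \<omega> * iexp (s * Z \<omega>) - cnj (U \<omega>) * iexp (s * Z \<omega>)))"
    proof (rule Bochner_Integration.integral_cong[OF refl])
      fix \<omega>
      have "complex_of_real (Im (U \<omega>)) = (- \<i>/2) * (U \<omega> - cnj (U \<omega>))"
        by (simp add: complex_eq_iff)
      thus "of_real (Im (U \<omega>)) * iexp (s * Z \<omega>)
          = (- \<i>/2) * (U \<omega> * iexp (s * Z \<omega>) - cnj (U \<omega>) * iexp (s * Z \<omega>))"
        by (simp only: left_diff_distrib mult.assoc)
    qed
    also have "\<dots> = (- \<i>/2) * ((CLINT \<omega>|M. U \<omega> * iexp (s * Z \<omega>)) - (CLINT \<omega>|M. cnj (U \<omega>) * iexp (s * Z \<omega>)))"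
      by (simp only: integral_mult_right_zero
          Bochner_Integration.integral_diff[OF int[OF U] int[OF integrable_cnj[OF U]]])
    finally show "(CLINT \<omega>|M. of_real (Im (U \<omega>)) * iexp (s * Z \<omega>)) = 0"
      by (simp only: zero zero') simp
  qed (use U in auto)
  have int': "integrable M (\<lambda>\<omega>. U \<omega> * indicator A (Z \<omega>))"
    by (rule Bochner_Integration.integrable_bound[OF U]) (auto simp: indicator_def)
  show ?thesis
  proof (rule complex_eqI)
    show "Re (CLINT \<omega>|M. U \<omega> * indicator A (Z \<omega>)) = Re 0"
    proof -
      have "Re (U \<omega> * indicator A (Z \<omega>)) = Re (U \<omega>) * indicator A (Z \<omega>)" for \<omega>
        by (simp add: indicator_def)
      thus ?thesis using re by (simp only: integral_Re[OF int', symmetric] zero_complex.sel)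
    qed
    show "Im (CLINT \<omega>|M. U \<omega> * indicator A (Z \<omega>)) = Im 0"
    proof -
      have "Im (U \<omega> * indicator A (Z \<omega>)) = Im (U \<omega>) * indicator A (Z \<omega>)" for \<omega>
        by (simp add: indicator_def)
      thus ?thesis using im by (simp only: integral_Im[OF int', symmetric] zero_complex.sel)
    qed
  qed
qed

text \<open>The exponentials in the \<open>\<zeta> j\<close> are replaced by indicators one index at a time, which
  reduces the multivariate statement to uniqueness of one-dimensional characteristic functions.\<close>
lemma (in prob_space) distr_pair_if_iexp_factor:
  fixes \<xi> :: "'a \<Rightarrow> real" and \<zeta> :: "'i \<Rightarrow> 'a \<Rightarrow> real"
  assumes \<xi> [measurable]: "random_variable borel \<xi>"
    and \<zeta> [measurable]: "\<And>i. random_variable borel (\<zeta> i)"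
    and factor: "\<And>J l s. finite J \<Longrightarrow>
      (CLINT \<omega>|M. iexp (s * \<xi> \<omega>) * iexp (\<Sum>j\<in>J. l j * \<zeta> j \<omega>))
        = (CLINT \<omega>|M. iexp (s * \<xi> \<omega>)) * (CLINT \<omega>|M. iexp (\<Sum>j\<in>J. l j * \<zeta> j \<omega>))"
  shows "distr M borel \<xi> \<Otimes>\<^sub>M distr M (PiM UNIV (\<lambda>_. borel)) (\<lambda>\<omega> i. \<zeta> i \<omega>)
    = distr M (borel \<Otimes>\<^sub>M PiM UNIV (\<lambda>_. borel)) (\<lambda>\<omega>. (\<xi> \<omega>, \<lambda>i. \<zeta> i \<omega>))"
proof -
  define G where "G K A = {\<omega> \<in> space M. \<forall>j\<in>K. \<zeta> j \<omega> \<in> A j}" for K A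
  have G [measurable]: "G K A \<in> events" if "finite K" "\<And>j. A j \<in> sets borel" for K A
    unfolding G_def using that by measurable
  define \<phi> where "\<phi> s = (CLINT \<omega>|M. iexp (s * \<xi> \<omega>))" for s
  \<comment> \<open>\<open>K\<close> collects the indices already converted to indicators,
    \<open>J\<close> those still carried by exponentials. The base case is the hypothesis
    \<open>factor\<close>, recentred by \<open>\<phi> s\<close>.\<close>
  have step: "(CLINT \<omega>|M. ((iexp (s * \<xi> \<omega>) - \<phi> s) * indicator (G K A) \<omega>) * iexp (\<Sum>j\<in>J. l j * \<zeta> j \<omega>)) = 0"
    if "finite K" "finite J" "K \<inter> J = {}" "\<And>j. A j \<in> sets borel" for K J A l s
    using that
  proof (induction K arbitrary: J l rule: finite_induct)
    case empty
    have "(CLINT \<omega>|M. ((iexp (s * \<xi> \<omega>) - \<phi> s) * indicator (G {} A) \<omega>) * iexp (\<Sum>j\<in>J. l j * \<zeta> j \<omega>))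
       = (CLINT \<omega>|M. iexp (s * \<xi> \<omega>) * iexp (\<Sum>j\<in>J. l j * \<zeta> j \<omega>) - \<phi> s * iexp (\<Sum>j\<in>J. l j * \<zeta> j \<omega>))"
      by (rule Bochner_Integration.integral_cong) (auto simp: G_def algebra_simps)
    also have "\<dots> = (CLINT \<omega>|M. iexp (s * \<xi> \<omega>) * iexp (\<Sum>j\<in>J. l j * \<zeta> j \<omega>)) - (CLINT \<omega>|M. \<phi> s * iexp (\<Sum>j\<in>J. l j * \<zeta> j \<omega>))"
    proof (rule Bochner_Integration.integral_diff)
      show "complex_integrable M (\<lambda>\<omega>. iexp (s * \<xi> \<omega>) * iexp (\<Sum>j\<in>J. l j * \<zeta> j \<omega>))"
        by (rule integrable_const_bound[where B=1]) (auto simp: norm_mult simp del: of_real_mult of_real_sum)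
      show "complex_integrable M (\<lambda>\<omega>. \<phi> s * iexp (\<Sum>j\<in>J. l j * \<zeta> j \<omega>))"
        by (rule integrable_const_bound[where B="norm (\<phi> s)"]) (auto simp: norm_mult simp del: of_real_mult of_real_sum)
    qed
    also have "\<dots> = 0"
      unfolding factor[OF empty(1)] \<phi>_def by (simp only: integral_mult_right_zero diff_self)
    finally show ?case .
  next
    case (insert k K)
    have [measurable]: "A j \<in> sets borel" for j by (fact insert.prems(3))
    have k: "k \<notin> J" using insert by auto
    define U where "U \<omega> = ((iexp (s * \<xi> \<omega>) - \<phi> s) * indicator (G K A) \<omega>) * iexp (\<Sum>j\<in>J. l j * \<zeta> j \<omega>)" for \<omega>
    have [measurable]: "G K A \<in> events" by (rule G) (use insert in auto)
    have [measurable]: "U \<in> borel_measurable M" unfolding U_def by measurable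
    have "(CLINT \<omega>|M. U \<omega> * indicator (A k) (\<zeta> k \<omega>)) = 0"
    proof (rule integral_iexp_eq_0)
      show "complex_integrable M U"
      proof (rule integrable_const_bound[where B="1 + norm (\<phi> s)"])
        show "AE \<omega> in M. cmod (U \<omega>) \<le> 1 + cmod (\<phi> s)"
        proof (rule AE_I2)
          fix \<omega>
          have "cmod (U \<omega>) \<le> cmod (iexp (s * \<xi> \<omega>) - \<phi> s)"
            unfolding U_def by (auto simp: norm_mult indicator_def simp del: of_real_mult of_real_sum)
          also have "\<dots> \<le> 1 + cmod (\<phi> s)"
            by (rule norm_triangle_le_diff) (simp del: of_real_mult)
          finally show "cmod (U \<omega>) \<le> 1 + cmod (\<phi> s)" .
        qed
      qed simp
      fix r
      \<comment> \<open>The induction hypothesis is used with \<open>k\<close> added to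
        \<open>J\<close> at an arbitrary frequency \<open>r\<close>. This says that the transform of
        \<open>U\<close> against \<open>\<zeta> k\<close> vanishes, so the exponential in
        \<open>\<zeta> k\<close> may be replaced by an indicator.\<close>
      define l' where "l' = l(k := r)"
      have eq: "(\<Sum>j\<in>insert k J. l' j * \<zeta> j \<omega>) = (\<Sum>j\<in>J. l j * \<zeta> j \<omega>) + r * \<zeta> k \<omega>" for \<omega>
      proof -
        have "(\<Sum>j\<in>J. l' j * \<zeta> j \<omega>) = (\<Sum>j\<in>J. l j * \<zeta> j \<omega>)"
          using k by (intro sum.cong) (auto simp: l'_def)
        thus ?thesis using k insert.prems(1) by (simp add: l'_def)
      qed
      have "(CLINT \<omega>|M. ((iexp (s * \<xi> \<omega>) - \<phi> s) * indicator (G K A) \<omega>) * iexp (\<Sum>j\<in>insert k J. l' j * \<zeta> j \<omega>)) = 0"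
        by (rule insert.IH) (use insert in auto)
      thus "(CLINT \<omega>|M. U \<omega> * iexp (r * \<zeta> k \<omega>)) = 0"
        unfolding eq U_def by (simp only: of_real_add distrib_left exp_add mult.assoc)
    qed auto
    also have "(CLINT \<omega>|M. U \<omega> * indicator (A k) (\<zeta> k \<omega>))
      = (CLINT \<omega>|M. ((iexp (s * \<xi> \<omega>) - \<phi> s) * indicator (G (insert k K) A) \<omega>) * iexp (\<Sum>j\<in>J. l j * \<zeta> j \<omega>))"
      by (rule Bochner_Integration.integral_cong) (auto simp: U_def G_def indicator_def)
    finally show ?case .
  qed
  have indep: "prob (\<xi> -` B \<inter> space M \<inter> G K A) = prob (\<xi> -` B \<inter> space M) * prob (G K A)"
    if K: "finite K" and A: "\<And>j. A j \<in> sets borel" and B [measurable]: "B \<in> sets borel" for K A B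
  proof -
    have [measurable]: "G K A \<in> events" by (rule G) (use K A in auto)
    \<comment> \<open>Now the roles are exchanged: the centred indicator of \<open>G K A\<close> is
      the density, and the exponential in \<open>\<xi>\<close> is the one to be replaced. Its
      transform vanishes by \<open>step\<close> with \<open>J\<close> empty.\<close>
    have "(\<integral>\<omega>. (indicator (G K A) \<omega> - prob (G K A)) * indicator B (\<xi> \<omega>) \<partial>M) = 0"
    proof (rule integral_iexp_eq_0_real)
      fix s
      have int1: "complex_integrable M (\<lambda>\<omega>. iexp (s * \<xi> \<omega>) * indicator (G K A) \<omega>)"
        by (rule integrable_const_bound[where B=1]) (auto simp: norm_mult indicator_def simp del: of_real_mult)
      have int2: "complex_integrable M (\<lambda>\<omega>. iexp (s * \<xi> \<omega>))"
        by (rule integrable_const_bound[where B=1]) (auto simp: norm_mult simp del: of_real_mult)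
      have int3: "complex_integrable M (\<lambda>\<omega>. indicator (G K A) \<omega>)"
        by (rule integrable_const_bound[where B=1]) (auto simp: indicator_def)
      have ind: "(CLINT \<omega>|M. indicator (G K A) \<omega>) = complex_of_real (prob (G K A))"
      proof -
        have "(CLINT \<omega>|M. indicator (G K A) \<omega>) = (CLINT \<omega>|M. complex_of_real (indicator (G K A) \<omega>))"
          by (simp add: of_real_indicator)
        also have "\<dots> = complex_of_real (prob (G K A))" by (subst integral_complex_of_real) simp
        finally show ?thesis .
      qed
      have "(CLINT \<omega>|M. complex_of_real (indicator (G K A) \<omega> - prob (G K A)) * iexp (s * \<xi> \<omega>))
        = (CLINT \<omega>|M. iexp (s * \<xi> \<omega>) * indicator (G K A) \<omega> - of_real (prob (G K A)) * iexp (s * \<xi> \<omega>))"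
        by (rule Bochner_Integration.integral_cong) (auto simp: indicator_def algebra_simps)
      also have "\<dots> = (CLINT \<omega>|M. iexp (s * \<xi> \<omega>) * indicator (G K A) \<omega>) - of_real (prob (G K A)) * \<phi> s"
        unfolding \<phi>_def
        by (subst Bochner_Integration.integral_diff[OF int1 integrable_mult_right[OF int2]])
          (simp only: integral_mult_right_zero)
      also have "\<dots> = (CLINT \<omega>|M. iexp (s * \<xi> \<omega>) * indicator (G K A) \<omega>) - (CLINT \<omega>|M. \<phi> s * indicator (G K A) \<omega>)"
        by (simp only: integral_mult_right_zero ind mult.commute)
      also have "\<dots> = (CLINT \<omega>|M. iexp (s * \<xi> \<omega>) * indicator (G K A) \<omega> - \<phi> s * indicator (G K A) \<omega>)"
        by (rule Bochner_Integration.integral_diff[symmetric, OF int1 integrable_mult_right[OF int3]])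
      also have "\<dots> = (CLINT \<omega>|M. ((iexp (s * \<xi> \<omega>) - \<phi> s) * indicator (G K A) \<omega>) * iexp (\<Sum>j\<in>{}. 0 * \<zeta> j \<omega>))"
        by (simp add: algebra_simps)
      also have "\<dots> = 0" by (rule step) (use K A in auto)
      finally show "(CLINT \<omega>|M. complex_of_real (indicator (G K A) \<omega> - prob (G K A)) * iexp (s * \<xi> \<omega>)) = 0" .
      show "integrable M (\<lambda>\<omega>. indicator (G K A) \<omega> - prob (G K A))"
        by (intro Bochner_Integration.integrable_diff integrable_const) (simp add: less_top[symmetric])
    qed auto
    also have "(\<integral>\<omega>. (indicator (G K A) \<omega> - prob (G K A)) * indicator B (\<xi> \<omega>) \<partial>M)
        = (\<integral>\<omega>. indicator (\<xi> -` B \<inter> space M \<inter> G K A) \<omega> - prob (G K A) * indicator (\<xi> -` B \<inter> space M) \<omega> \<partial>M)"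
      by (rule Bochner_Integration.integral_cong) (auto simp: indicator_def)
    also have "\<dots> = prob (\<xi> -` B \<inter> space M \<inter> G K A) - prob (G K A) * prob (\<xi> -` B \<inter> space M)"
      by (subst Bochner_Integration.integral_diff)
        (auto simp: less_top[symmetric] Int_absorb2 intro!: integrable_mult_right)
    finally show ?thesis by simp
  qed
  have \<zeta>_PiM: "(\<lambda>\<omega> i. \<zeta> i \<omega>) \<in> measurable M (PiM UNIV (\<lambda>_. borel))"
    by (rule measurable_PiM_single') auto
  \<comment> \<open>Pulling back commutes with generating a sigma-algebra, so independence need only
    be checked on preimages of finite-dimensional cylinders, an intersection-stable family.\<close>
  have sets_\<zeta>: "{(\<lambda>\<omega> i. \<zeta> i \<omega>) -` A \<inter> space M |A. A \<in> sets (PiM UNIV (\<lambda>_. borel))}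
     = sigma_sets (space M) {(\<lambda>\<omega> i. \<zeta> i \<omega>) -` A \<inter> space M |A. A \<in> prod_algebra UNIV (\<lambda>_. borel)}"
    unfolding sets_PiM by (rule sigma_sets_vimage_commute) auto
  have "indep_set (sigma_sets (space M) {\<xi> -` B \<inter> space M |B. B \<in> sets borel})
     (sigma_sets (space M) {(\<lambda>\<omega> i. \<zeta> i \<omega>) -` A \<inter> space M |A. A \<in> prod_algebra UNIV (\<lambda>_. borel)})"
  proof (rule indep_set_sigma_sets)
    show "Int_stable {\<xi> -` B \<inter> space M |B. B \<in> sets borel}"
    proof (safe intro!: Int_stableI)
      fix A B :: "real set" assume "A \<in> sets borel" "B \<in> sets borel"
      thus "\<exists>C. (\<xi> -` A \<inter> space M) \<inter> (\<xi> -` B \<inter> space M) = \<xi> -` C \<inter> space M \<and> C \<in> sets borel"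
        by (intro exI[of _ "A \<inter> B"]) auto
    qed
    show "Int_stable {(\<lambda>\<omega> i. \<zeta> i \<omega>) -` A \<inter> space M |A. A \<in> prod_algebra UNIV (\<lambda>_. borel)}"
    proof (safe intro!: Int_stableI)
      fix A B :: "('i \<Rightarrow> real) set"
      assume "A \<in> prod_algebra UNIV (\<lambda>_. borel)" "B \<in> prod_algebra UNIV (\<lambda>_. borel)"
      hence "A \<inter> B \<in> prod_algebra UNIV (\<lambda>_. borel)"
        by (rule Int_stableD[OF Int_stable_prod_algebra])
      thus "\<exists>C. ((\<lambda>\<omega> i. \<zeta> i \<omega>) -` A \<inter> space M) \<inter> ((\<lambda>\<omega> i. \<zeta> i \<omega>) -` B \<inter> space M)
          = (\<lambda>\<omega> i. \<zeta> i \<omega>) -` C \<inter> space M \<and> C \<in> prod_algebra UNIV (\<lambda>_. borel)"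
        by (intro exI[of _ "A \<inter> B"]) auto
    qed
    show "indep_set {\<xi> -` B \<inter> space M |B. B \<in> sets borel}
      {(\<lambda>\<omega> i. \<zeta> i \<omega>) -` A \<inter> space M |A. A \<in> prod_algebra UNIV (\<lambda>_. borel)}"
    proof (rule indep_setI)
      show "{\<xi> -` B \<inter> space M |B. B \<in> sets borel} \<subseteq> events" by auto
      show "{(\<lambda>\<omega> i. \<zeta> i \<omega>) -` A \<inter> space M |A. A \<in> prod_algebra UNIV (\<lambda>_. borel)} \<subseteq> events"
        using measurable_sets[OF \<zeta>_PiM] by (auto simp: sets_PiM intro: sigma_sets.Basic)
      fix a b assume "a \<in> {\<xi> -` B \<inter> space M |B. B \<in> sets borel}"
        and "b \<in> {(\<lambda>\<omega> i. \<zeta> i \<omega>) -` A \<inter> space M |A. A \<in> prod_algebra UNIV (\<lambda>_. borel)}"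
      then obtain A B where a: "a = \<xi> -` B \<inter> space M" "B \<in> sets borel"
        and b: "b = (\<lambda>\<omega> i. \<zeta> i \<omega>) -` A \<inter> space M" and A: "A \<in> prod_algebra UNIV (\<lambda>_::'i. borel::real measure)"
        by auto
      from A obtain J E where J: "A = prod_emb UNIV (\<lambda>_. borel) J (\<Pi>\<^sub>E j\<in>J. E j)" "finite J"
        "\<And>i. i \<in> J \<Longrightarrow> E i \<in> sets (borel :: real measure)"
        by (rule prod_algebraE) auto
      \<comment> \<open>\<open>indep\<close> asks for a Borel set at every index; outside
        \<open>J\<close> the whole line leaves the cylinder unchanged.\<close>
      define E' where "E' i = (if i \<in> J then E i else UNIV)" for i
      have "b = G J E'"
        unfolding b J G_def by (auto simp: prod_emb_def restrict_PiE_iff E'_def)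
      moreover have "E' j \<in> sets borel" for j using J(3) by (auto simp: E'_def)
      ultimately show "prob (a \<inter> b) = prob a * prob b"
        using indep[OF J(2), of E' B] a by simp
    qed
  qed
  note indep' = indep_setD[OF this, folded sets_\<zeta>]
  let ?P = "distr M borel \<xi>" and ?Q = "distr M (PiM UNIV (\<lambda>_. borel)) (\<lambda>\<omega> i. \<zeta> i \<omega>)"
  interpret P: prob_space ?P by (rule prob_space_distr) simp
  interpret Q: prob_space ?Q by (rule prob_space_distr) (fact \<zeta>_PiM)
  show ?thesis
  proof (rule pair_measure_eqI)
    fix B A assume B: "B \<in> sets ?P" and A: "A \<in> sets ?Q"
    have pair: "(\<lambda>\<omega>. (\<xi> \<omega>, \<lambda>i. \<zeta> i \<omega>)) \<in> measurable M (borel \<Otimes>\<^sub>M PiM UNIV (\<lambda>_. borel))"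
      by (rule measurable_Pair[OF \<xi> \<zeta>_PiM])
    have "emeasure ?P B * emeasure ?Q A
        = ennreal (prob (\<xi> -` B \<inter> space M) * prob ((\<lambda>\<omega> i. \<zeta> i \<omega>) -` A \<inter> space M))"
      using A B \<zeta>_PiM by (simp add: emeasure_distr emeasure_eq_measure ennreal_mult)
    also have "\<dots> = ennreal (prob ((\<xi> -` B \<inter> space M) \<inter> ((\<lambda>\<omega> i. \<zeta> i \<omega>) -` A \<inter> space M)))"
      using A B by (subst indep') (auto intro: sigma_sets.Basic)
    also have "(\<xi> -` B \<inter> space M) \<inter> ((\<lambda>\<omega> i. \<zeta> i \<omega>) -` A \<inter> space M)
        = (\<lambda>\<omega>. (\<xi> \<omega>, \<lambda>i. \<zeta> i \<omega>)) -` (B \<times> A) \<inter> space M" by auto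
    also have "ennreal (prob \<dots>)
        = emeasure (distr M (borel \<Otimes>\<^sub>M PiM UNIV (\<lambda>_. borel)) (\<lambda>\<omega>. (\<xi> \<omega>, \<lambda>i. \<zeta> i \<omega>))) (B \<times> A)"
      using A B by (subst emeasure_distr[OF pair]) (auto simp: emeasure_eq_measure)
    finally show "emeasure ?P B * emeasure ?Q A
        = emeasure (distr M (borel \<Otimes>\<^sub>M PiM UNIV (\<lambda>_. borel)) (\<lambda>\<omega>. (\<xi> \<omega>, \<lambda>i. \<zeta> i \<omega>))) (B \<times> A)" .
  qed (auto simp: P.sigma_finite_measure_axioms Q.sigma_finite_measure_axioms intro!: sets_pair_measure_cong)
qed

section \<open>Gaussian integration by parts\<close>

lemma (in prob_space) centered_gaussian_cases:
  assumes "gaussian_variable M Y" and "expectation Y = 0"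
  obtains (degenerate) "AE \<omega> in M. Y \<omega> = 0"
    | (normal) \<sigma> where "\<sigma> > 0" "distributed M lborel Y (normal_density 0 \<sigma>)"
  using assms(1) unfolding gaussian_variable_def
proof (elim conjE disjE exE)
  fix \<mu> assume [measurable]: "random_variable borel Y" and \<mu>: "AE \<omega> in M. Y \<omega> = \<mu>"
  have "expectation Y = expectation (\<lambda>_. \<mu>)"
    by (rule integral_cong_AE) (use \<mu> in auto)
  hence "\<mu> = 0" using assms(2) by (simp add: prob_space)
  with \<mu> show thesis using degenerate by simp
next
  fix \<mu> \<sigma> :: real assume "\<sigma> > 0" "distributed M lborel Y (normal_density \<mu> \<sigma>)"
  with normal_distributed_expectation[of \<sigma> Y \<mu>] assms(2) show thesis using normal by simp
qed

lemma (in prob_space) gaussian_variable_integrable: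
  assumes "gaussian_variable M Y"
  shows "integrable M Y" and "integrable M (\<lambda>\<omega>. (Y \<omega>)\<^sup>2)"
proof -
  have [measurable]: "random_variable borel Y" using assms by (simp add: gaussian_variable_def)
  have "integrable M Y \<and> integrable M (\<lambda>\<omega>. (Y \<omega>)\<^sup>2)"
    using assms unfolding gaussian_variable_def
  proof (elim conjE disjE exE)
    fix \<mu> assume \<mu>: "AE \<omega> in M. Y \<omega> = \<mu>"
    have "integrable M Y \<longleftrightarrow> integrable M (\<lambda>_. \<mu>)"
      by (rule integrable_cong_AE) (use \<mu> in auto)
    moreover have "integrable M (\<lambda>\<omega>. (Y \<omega>)\<^sup>2) \<longleftrightarrow> integrable M (\<lambda>_. \<mu>\<^sup>2)"
      by (rule integrable_cong_AE) (use \<mu> in auto)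
    ultimately show ?thesis by simp
  next
    fix \<mu> \<sigma> :: real assume \<sigma>: "\<sigma> > 0" and D: "distributed M lborel Y (normal_density \<mu> \<sigma>)"
    have 1: "integrable M Y"
      using distributed_integrable[OF D, of "\<lambda>x. x"] integrable_normal_moment_nz_1[OF \<sigma>, of \<mu>] by simp
    have "integrable M (\<lambda>\<omega>. (Y \<omega> - \<mu>)\<^sup>2)"
      using distributed_integrable[OF D, of "\<lambda>x. (x - \<mu>)\<^sup>2"] integrable_normal_moment[OF \<sigma>, of \<mu> 2] by simp
    hence "integrable M (\<lambda>\<omega>. (Y \<omega> - \<mu>)\<^sup>2 + 2 * \<mu> * Y \<omega> - \<mu>\<^sup>2)"
      using 1 by simp
    hence "integrable M (\<lambda>\<omega>. (Y \<omega>)\<^sup>2)" by (simp add: power2_eq_square algebra_simps)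
    with 1 show ?thesis by simp
  qed
  thus "integrable M Y" and "integrable M (\<lambda>\<omega>. (Y \<omega>)\<^sup>2)" by auto
qed

text \<open>Expressing the exponent through the second moment treats the point mass at 0 and the
  normal law uniformly, and reduces factorisation of characteristic functions to additivity of
  second moments.\<close>

lemma (in prob_space) iexp_centered_gaussian:
  assumes "gaussian_variable M Y" and "expectation Y = 0"
  shows "(CLINT \<omega>|M. iexp (Y \<omega>)) = of_real (exp (- expectation (\<lambda>\<omega>. (Y \<omega>)\<^sup>2) / 2))"
  using assms
proof (cases rule: centered_gaussian_cases)
  case degenerate
  have [measurable]: "random_variable borel Y" using assms by (simp add: gaussian_variable_def)
  have "(CLINT \<omega>|M. iexp (Y \<omega>)) = (CLINT \<omega>|M. 1)"
    by (rule integral_cong_AE) (use degenerate in auto)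
  moreover have "expectation (\<lambda>\<omega>. (Y \<omega>)\<^sup>2) = expectation (\<lambda>_. 0)"
    by (rule integral_cong_AE) (use degenerate in auto)
  ultimately show ?thesis by (simp add: prob_space)
next
  case (normal \<sigma>)
  have [measurable]: "random_variable borel Y" using assms by (simp add: gaussian_variable_def)
  have var: "expectation (\<lambda>\<omega>. (Y \<omega>)\<^sup>2) = \<sigma>\<^sup>2"
    using normal_distributed_variance[OF normal] assms(2) by simp
  have D: "distributed M lborel (\<lambda>\<omega>. Y \<omega> / \<sigma>) std_normal_density"
    using normal normal_standard_normal_convert[of \<sigma> Y 0] by simp
  have "(CLINT \<omega>|M. iexp (Y \<omega>)) = (CLINT \<omega>|M. iexp (\<sigma> * (Y \<omega> / \<sigma>)))"
    using normal(1) by simp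
  also have "\<dots> = (CLINT x|distr M lborel (\<lambda>\<omega>. Y \<omega> / \<sigma>). iexp (\<sigma> * x))"
    by (subst integral_distr) auto
  also have "distr M lborel (\<lambda>\<omega>. Y \<omega> / \<sigma>) = std_normal_distribution"
    using D by (simp add: distributed_def)
  also have "(CLINT x|std_normal_distribution. iexp (\<sigma> * x)) = of_real (exp (- \<sigma>\<^sup>2 / 2))"
    using fun_cong[OF char_std_normal_distribution, of \<sigma>] by (simp add: char_def)
  finally show ?thesis by (simp only: var)
qed

text \<open>The centred normal density satisfies
  \<open>\<phi>' x = - (x / \<sigma>^2) * \<phi> x\<close>. Hence the difference of the two sides
  is, up to the factor \<open>\<sigma>^2\<close>, the integral over the line of the derivative of
  \<open>g x * \<phi> x\<close>, which tends to 0 at both ends.\<close>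

lemma normal_density_integration_by_parts:
  fixes g g' :: "real \<Rightarrow> real"
  assumes \<sigma>: "\<sigma> > 0"
    and deriv: "\<And>x. (g has_real_derivative g' x) (at x)"
    and bdd: "\<And>x. \<bar>g x\<bar> \<le> C" "\<And>x. \<bar>g' x\<bar> \<le> C"
    and g' [measurable]: "g' \<in> borel_measurable borel"
  shows "(\<integral>x. normal_density 0 \<sigma> x * (x * g x) \<partial>lborel)
    = \<sigma>\<^sup>2 * (\<integral>x. normal_density 0 \<sigma> x * g' x \<partial>lborel)"
proof -
  let ?\<phi> = "normal_density 0 \<sigma>"
  have cont: "continuous_on UNIV g"
    using deriv by (intro continuous_at_imp_continuous_on ballI DERIV_isCont) auto
  hence g [measurable]: "g \<in> borel_measurable borel" by (rule borel_measurable_continuous_onI)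
  define F where "F x = g x * ?\<phi> x" for x
  define F' where "F' x = ?\<phi> x * g' x - (?\<phi> x * (x * g x)) / \<sigma>\<^sup>2" for x
  have \<phi>': "(?\<phi> has_real_derivative - (x / \<sigma>\<^sup>2) * ?\<phi> x) (at x)" for x
    unfolding normal_density_def
    by (rule derivative_eq_intros refl | use \<sigma> in \<open>simp add: field_simps power2_eq_square\<close>)+
  have F': "(F has_real_derivative F' x) (at x)" for x
    unfolding F_def F'_def
    by (rule DERIV_cong[OF DERIV_mult[OF deriv \<phi>']]) (simp add: field_simps)
  have int1: "integrable lborel (\<lambda>x. ?\<phi> x * g' x)"
  proof (rule Bochner_Integration.integrable_bound)
    show "integrable lborel (\<lambda>x. ?\<phi> x * C)" using \<sigma> by simp
    show "AE x in lborel. norm (?\<phi> x * g' x) \<le> norm (?\<phi> x * C)"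
      using bdd(2) by (auto simp: abs_mult intro!: mult_left_mono order_trans[OF _ abs_ge_self])
  qed simp
  have int2: "integrable lborel (\<lambda>x. ?\<phi> x * (x * g x))"
  proof (rule Bochner_Integration.integrable_bound)
    show "integrable lborel (\<lambda>x. (?\<phi> x * x) * C)"
      using integrable_normal_moment_nz_1[OF \<sigma>, of 0] by (intro integrable_mult_left) simp
    show "AE x in lborel. norm (?\<phi> x * (x * g x)) \<le> norm (?\<phi> x * x * C)"
    proof (rule AE_I2)
      fix x
      have "\<bar>g x\<bar> \<le> \<bar>C\<bar>" using bdd(1)[of x] by linarith
      thus "norm (?\<phi> x * (x * g x)) \<le> norm (?\<phi> x * x * C)"
        by (simp add: abs_mult mult.assoc mult_left_mono)
    qed
  qed simp
  have intF': "integrable lborel F'" unfolding F'_def using int1 int2 by simp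
  have 1: "(\<lambda>n. \<integral>x. indicator {- real n..real n} x *\<^sub>R F' x \<partial>lborel) \<longlonglongrightarrow> (\<integral>x. F' x \<partial>lborel)"
  proof (rule integral_dominated_convergence[where w = "\<lambda>x. \<bar>F' x\<bar>"])
    show "AE x in lborel. (\<lambda>n. indicator {- real n..real n} x *\<^sub>R F' x) \<longlonglongrightarrow> F' x"
    proof (rule AE_I2, rule tendsto_eventually)
      fix x :: real
      obtain N where N: "\<bar>x\<bar> \<le> real N" using real_arch_simple by blast
      show "\<forall>\<^sub>F n in sequentially. indicator {- real n..real n} x *\<^sub>R F' x = F' x"
        using eventually_ge_at_top[of N]
        by eventually_elim (use N in \<open>auto simp: indicator_def abs_le_iff\<close>)
    qed
    show "AE x in lborel. norm (indicator {- real n..real n} x *\<^sub>R F' x) \<le> \<bar>F' x\<bar>" for n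
      by (rule AE_I2) (simp add: indicator_def)
    show "integrable lborel (\<lambda>x. \<bar>F' x\<bar>)" using intF' by simp
    show [measurable]: "F' \<in> borel_measurable lborel" using intF' by simp
    show "(\<lambda>x. indicator {- real n..real n} x *\<^sub>R F' x) \<in> borel_measurable lborel" for n
      by measurable
  qed
  \<comment> \<open>\<open>g'\<close> is merely bounded and measurable; the fundamental theorem for
    the gauge integral requires no continuity of the derivative, and the two integrals agree on a
    compact interval.\<close>
  have 2: "(\<integral>x. indicator {- real n..real n} x *\<^sub>R F' x \<partial>lborel) = F (real n) - F (- real n)" for n
  proof -
    have "set_integrable lborel {- real n..real n} F'"
      unfolding set_integrable_def by (rule integrable_mult_indicator[OF _ intF']) simp
    hence "(LBINT x:{- real n..real n}. F' x) = integral {- real n..real n} F'"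
      by (rule set_borel_integral_eq_integral)
    also have "\<dots> = F (real n) - F (- real n)"
    proof (intro integral_unique fundamental_theorem_of_calculus)
      fix x
      show "(F has_vector_derivative F' x) (at x within {- real n..real n})"
        using has_field_derivative_at_within[OF F']
        by (simp only: has_real_derivative_iff_has_vector_derivative)
    qed simp
    finally show ?thesis by (simp add: set_lebesgue_integral_def)
  qed
  have \<phi>0: "(\<lambda>n. ?\<phi> (real n)) \<longlonglongrightarrow> 0"
  proof -
    have "filterlim (\<lambda>n. (1 / (2 * \<sigma>\<^sup>2)) * (real n)\<^sup>2) at_top sequentially"
      using \<sigma> by (intro filterlim_tendsto_pos_mult_at_top[OF tendsto_const] filterlim_pow_at_top filterlim_real_sequentially) auto
    hence "filterlim (\<lambda>n. - ((1 / (2 * \<sigma>\<^sup>2)) * (real n)\<^sup>2)) at_bot sequentially"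
      by (rule filterlim_uminus_at_bot_at_top[THEN filterlim_compose, unfolded o_def])
    hence "(\<lambda>n. exp (- ((1 / (2 * \<sigma>\<^sup>2)) * (real n)\<^sup>2))) \<longlonglongrightarrow> 0"
      by (rule filterlim_compose[OF exp_at_bot])
    hence "(\<lambda>n. 1 / sqrt (2 * pi * \<sigma>\<^sup>2) * exp (- ((1 / (2 * \<sigma>\<^sup>2)) * (real n)\<^sup>2))) \<longlonglongrightarrow> 0"
      by (rule tendsto_mult_right_zero)
    thus ?thesis by (simp add: normal_density_def)
  qed
  have "(\<lambda>n. F (real n) - F (- real n)) \<longlonglongrightarrow> 0"
  proof (rule Lim_null_comparison)
    show "\<forall>\<^sub>F n in sequentially. norm (F (real n) - F (- real n)) \<le> (2 * C) * ?\<phi> (real n)"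
    proof (rule always_eventually, rule allI)
      fix n
      have sym: "?\<phi> (- real n) = ?\<phi> (real n)" by (simp add: normal_density_def)
      have "\<bar>F (real n) - F (- real n)\<bar> = \<bar>g (real n) - g (- real n)\<bar> * ?\<phi> (real n)"
        unfolding F_def sym by (simp flip: left_diff_distrib add: abs_mult)
      also have "\<dots> \<le> (2 * C) * ?\<phi> (real n)"
        using bdd(1)[of "real n"] bdd(1)[of "- real n"] by (intro mult_right_mono) auto
      finally show "norm (F (real n) - F (- real n)) \<le> (2 * C) * ?\<phi> (real n)" by simp
    qed
    show "(\<lambda>n. (2 * C) * ?\<phi> (real n)) \<longlonglongrightarrow> 0" by (rule tendsto_mult_right_zero[OF \<phi>0])
  qed
  with 1 have "(\<integral>x. F' x \<partial>lborel) = 0" unfolding 2 by (rule LIMSEQ_unique)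
  hence "(\<integral>x. ?\<phi> x * g' x \<partial>lborel) - (\<integral>x. ?\<phi> x * (x * g x) \<partial>lborel) / \<sigma>\<^sup>2 = 0"
    unfolding F'_def using int1 int2 by simp
  thus ?thesis using \<sigma> by (simp add: field_simps)
qed

lemma gaussian_process_linear:
  assumes B: "gaussian_process M T B"
    and fin: "\<And>j. j \<in> S \<Longrightarrow> finite (I j)" and sub: "\<And>j. j \<in> S \<Longrightarrow> I j \<subseteq> T"
  shows "gaussian_process M S (\<lambda>j \<omega>. \<Sum>i\<in>I j. a j i * B i \<omega>)"
  unfolding gaussian_process_def
proof (intro allI impI, elim conjE)
  fix J c assume J: "finite J" "J \<subseteq> S"
  define K where "K = (\<Union>j\<in>J. I j)"
  have K: "finite K" "K \<subseteq> T" unfolding K_def using J fin sub by auto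
  define d where "d i = (\<Sum>j\<in>J. if i \<in> I j then c j * a j i else 0)" for i
  have eq: "(\<Sum>j\<in>J. c j * (\<Sum>i\<in>I j. a j i * B i \<omega>)) = (\<Sum>i\<in>K. d i * B i \<omega>)" for \<omega>
  proof -
    have "(\<Sum>j\<in>J. c j * (\<Sum>i\<in>I j. a j i * B i \<omega>))
        = (\<Sum>j\<in>J. \<Sum>i\<in>K. if i \<in> I j then c j * a j i * B i \<omega> else 0)"
    proof (rule sum.cong[OF refl])
      fix j assume "j \<in> J"
      hence "K \<inter> I j = I j" by (auto simp: K_def)
      thus "c j * (\<Sum>i\<in>I j. a j i * B i \<omega>) = (\<Sum>i\<in>K. if i \<in> I j then c j * a j i * B i \<omega> else 0)"
        using K by (simp add: sum.inter_restrict[symmetric] sum_distrib_left mult.assoc)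
    qed
    also have "\<dots> = (\<Sum>i\<in>K. d i * B i \<omega>)"
      unfolding d_def by (subst sum.swap) (auto simp: sum_distrib_right intro!: sum.cong)
    finally show ?thesis .
  qed
  show "gaussian_variable M (\<lambda>\<omega>. \<Sum>j\<in>J. c j * (\<Sum>i\<in>I j. a j i * B i \<omega>))"
    unfolding eq using B K by (simp add: gaussian_process_def)
qed

lemma gaussian_processD:
  assumes "gaussian_process M T B" "i \<in> T"
  shows "gaussian_variable M (B i)"
  using assms unfolding gaussian_process_def by (elim allE[of _ "{i}"] allE[of _ "\<lambda>_. 1"]) simp

lemma (in prob_space) gaussian_process_integrable_mult:
  assumes "gaussian_process M T B" "i \<in> T" "j \<in> T"
  shows "integrable M (\<lambda>\<omega>. B i \<omega> * B j \<omega>)"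
proof -
  note gi = gaussian_processD[OF assms(1,2)] and gj = gaussian_processD[OF assms(1,3)]
  have [measurable]: "random_variable borel (B i)" "random_variable borel (B j)"
    using gi gj by (auto simp: gaussian_variable_def)
  show ?thesis
  proof (rule Bochner_Integration.integrable_bound)
    show "integrable M (\<lambda>\<omega>. (B i \<omega>)\<^sup>2 + (B j \<omega>)\<^sup>2)"
      using gaussian_variable_integrable(2)[OF gi] gaussian_variable_integrable(2)[OF gj] by simp
    show "AE \<omega> in M. norm (B i \<omega> * B j \<omega>) \<le> norm ((B i \<omega>)\<^sup>2 + (B j \<omega>)\<^sup>2)"
    proof (rule AE_I2)
      fix \<omega>
      have "2 * \<bar>B i \<omega>\<bar> * \<bar>B j \<omega>\<bar> \<le> \<bar>B i \<omega>\<bar>\<^sup>2 + \<bar>B j \<omega>\<bar>\<^sup>2" by (rule sum_squares_bound)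
      moreover have "0 \<le> \<bar>B i \<omega>\<bar> * \<bar>B j \<omega>\<bar>" by simp
      ultimately show "norm (B i \<omega> * B j \<omega>) \<le> norm ((B i \<omega>)\<^sup>2 + (B j \<omega>)\<^sup>2)"
        unfolding real_norm_def abs_mult power2_abs by linarith
    qed
  qed simp
qed

text \<open>Regress every \<open>\<eta> i\<close> on \<open>\<eta> k\<close>. The residuals are
  uncorrelated with \<open>\<eta> k\<close> and, by joint Gaussianity, independent of it, so with
  the residuals frozen the claim is the one-dimensional formula. Only the direction given by the
  covariances with \<open>\<eta> k\<close> is ever explored, which is why a single directional
  derivative suffices even for an infinite index type.\<close>

lemma (in prob_space) gaussian_integration_by_parts:
  fixes \<eta> :: "'i \<Rightarrow> 'a \<Rightarrow> real" and F F' :: "('i \<Rightarrow> real) \<Rightarrow> real"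
  assumes \<eta>: "gaussian_process M UNIV \<eta>" and mean: "\<And>i. expectation (\<eta> i) = 0"
    and F [measurable]: "F \<in> borel_measurable (PiM UNIV (\<lambda>_. borel))"
    and F' [measurable]: "F' \<in> borel_measurable (PiM UNIV (\<lambda>_. borel))"
    and bdd: "\<And>v. \<bar>F v\<bar> \<le> C" "\<And>v. \<bar>F' v\<bar> \<le> C"
    and deriv: "\<And>v. ((\<lambda>x. F (\<lambda>i. v i + x * expectation (\<lambda>\<omega>. \<eta> i \<omega> * \<eta> k \<omega>)))
      has_real_derivative F' v) (at 0)"
  shows "expectation (\<lambda>\<omega>. \<eta> k \<omega> * F (\<lambda>i. \<eta> i \<omega>)) = expectation (\<lambda>\<omega>. F' (\<lambda>i. \<eta> i \<omega>))"
proof -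
  define c where "c i = expectation (\<lambda>\<omega>. \<eta> i \<omega> * \<eta> k \<omega>)" for i
  have gv: "gaussian_variable M (\<eta> i)" for i using gaussian_processD[OF \<eta>] by simp
  have [measurable]: "random_variable borel (\<eta> i)" for i
    using gv by (auto simp: gaussian_variable_def)
  have int: "integrable M (\<eta> i)" for i using gaussian_variable_integrable[OF gv] by simp
  have int_mult: "integrable M (\<lambda>\<omega>. \<eta> i \<omega> * \<eta> j \<omega>)" for i j
    using gaussian_process_integrable_mult[OF \<eta>] by simp
  have \<eta>_PiM [measurable]: "(\<lambda>\<omega> i. \<eta> i \<omega>) \<in> measurable M (PiM UNIV (\<lambda>_. borel))"
    by (rule measurable_PiM_single') auto
  from gv[of k] mean[of k] show ?thesis
  proof (cases rule: centered_gaussian_cases)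
    case degenerate
    \<comment> \<open>If \<open>\<eta> k\<close> vanishes almost surely, so does the direction of
      differentiation; then \<open>F'\<close> is 0 and both sides are 0.\<close>
    have "c i = expectation (\<lambda>_. 0)" for i
      unfolding c_def by (rule integral_cong_AE) (use degenerate in auto)
    hence "((\<lambda>x. F v) has_real_derivative F' v) (at 0)" for v
      using deriv[of v] unfolding c_def[symmetric] by simp
    hence "F' v = 0" for v using DERIV_unique DERIV_const by blast
    moreover have "expectation (\<lambda>\<omega>. \<eta> k \<omega> * F (\<lambda>i. \<eta> i \<omega>)) = expectation (\<lambda>_. 0)"
      by (rule integral_cong_AE) (use degenerate in auto)
    ultimately show ?thesis by simp
  next
    case (normal \<sigma>)
    let ?\<phi> = "normal_density 0 \<sigma>"
    have ck: "c k = \<sigma>\<^sup>2"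
      using normal_distributed_variance[OF normal] mean[of k] by (simp add: c_def power2_eq_square)
    have ck0: "c k > 0" using normal(1) by (simp add: ck)
    \<comment> \<open>Regression coefficients: exactly this choice makes the residual
      \<open>\<zeta> i\<close> orthogonal to \<open>\<eta> k\<close>.\<close>
    define b where "b i = c i / c k" for i
    define \<zeta> where "\<zeta> i \<omega> = \<eta> i \<omega> - b i * \<eta> k \<omega>" for i \<omega>
    have \<zeta>_rv [measurable]: "random_variable borel (\<zeta> i)" for i unfolding \<zeta>_def by measurable
    have \<zeta>_PiM [measurable]: "(\<lambda>\<omega> i. \<zeta> i \<omega>) \<in> measurable M (PiM UNIV (\<lambda>_. borel))"
      by (rule measurable_PiM_single') auto
    have comb: "gaussian_variable M (\<lambda>\<omega>. s * \<eta> k \<omega> + (\<Sum>j\<in>J. l j * \<zeta> j \<omega>))"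
      if J: "finite J" for J l s
    proof -
      \<comment> \<open>Expanding the residuals puts an extra \<open>- l j * b j\<close> on
        \<open>\<eta> k\<close> for each \<open>j\<close>; these are collected at the index
        \<open>k\<close>, whether or not \<open>k\<close> lies in \<open>J\<close>.\<close>
      define d where "d i = (if i \<in> J then l i else 0) + (if i = k then s - (\<Sum>j\<in>J. l j * b j) else 0)" for i
      have "s * \<eta> k \<omega> + (\<Sum>j\<in>J. l j * \<zeta> j \<omega>) = (\<Sum>i\<in>insert k J. d i * \<eta> i \<omega>)" for \<omega>
      proof -
        have "(\<Sum>i\<in>insert k J. d i * \<eta> i \<omega>)
          = (\<Sum>i\<in>insert k J. if i \<in> J then l i * \<eta> i \<omega> else 0)
            + (\<Sum>i\<in>insert k J. if i = k then (s - (\<Sum>j\<in>J. l j * b j)) * \<eta> k \<omega> else 0)"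
          unfolding d_def by (subst sum.distrib[symmetric]) (auto intro!: sum.cong simp: algebra_simps)
        also have "(\<Sum>i\<in>insert k J. if i \<in> J then l i * \<eta> i \<omega> else 0) = (\<Sum>i\<in>J. l i * \<eta> i \<omega>)"
          using J by (subst sum.inter_restrict[symmetric]) (auto intro!: sum.cong)
        also have "(\<Sum>i\<in>insert k J. if i = k then (s - (\<Sum>j\<in>J. l j * b j)) * \<eta> k \<omega> else 0)
          = (s - (\<Sum>j\<in>J. l j * b j)) * \<eta> k \<omega>" using J by simp
        also have "(\<Sum>i\<in>J. l i * \<eta> i \<omega>) + \<dots> = s * \<eta> k \<omega> + (\<Sum>j\<in>J. l j * \<zeta> j \<omega>)"
          unfolding \<zeta>_def by (simp add: algebra_simps sum_subtractf sum_distrib_left sum_distrib_right)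
        finally show ?thesis by simp
      qed
      thus ?thesis using \<eta> J by (simp add: gaussian_process_def)
    qed
    have \<zeta>_mean: "expectation (\<zeta> i) = 0" for i
      unfolding \<zeta>_def using int mean by simp
    have int_\<zeta>: "integrable M (\<zeta> i)" for i unfolding \<zeta>_def using int by simp
    have int_\<zeta>\<eta>: "integrable M (\<lambda>\<omega>. \<zeta> i \<omega> * \<eta> k \<omega>)" for i
      unfolding \<zeta>_def using int_mult by (simp add: left_diff_distrib mult.assoc)
    have orth: "expectation (\<lambda>\<omega>. \<zeta> i \<omega> * \<eta> k \<omega>) = 0" for i
    proof -
      have "expectation (\<lambda>\<omega>. \<zeta> i \<omega> * \<eta> k \<omega>) = c i - b i * c k"
        unfolding \<zeta>_def c_def using int_mult by (simp add: left_diff_distrib mult.assoc)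
      thus ?thesis using ck0 by (simp add: b_def)
    qed
    have "distr M borel (\<eta> k) \<Otimes>\<^sub>M distr M (PiM UNIV (\<lambda>_. borel)) (\<lambda>\<omega> i. \<zeta> i \<omega>)
      = distr M (borel \<Otimes>\<^sub>M PiM UNIV (\<lambda>_. borel)) (\<lambda>\<omega>. (\<eta> k \<omega>, \<lambda>i. \<zeta> i \<omega>))"
    proof (rule distr_pair_if_iexp_factor)
      fix J :: "'i set" and l s assume J: "finite J"
      define L where "L \<omega> = (\<Sum>j\<in>J. l j * \<zeta> j \<omega>)" for \<omega>
      have gL: "gaussian_variable M L" and gk: "gaussian_variable M (\<lambda>\<omega>. s * \<eta> k \<omega>)"
        and gkL: "gaussian_variable M (\<lambda>\<omega>. s * \<eta> k \<omega> + L \<omega>)"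
        using comb[OF J, of 0 l] comb[of "{}" s] comb[OF J, of s l] by (simp_all add: L_def[abs_def])
      have intL: "integrable M L" unfolding L_def using int_\<zeta> by simp
      have mL: "expectation L = 0"
        unfolding L_def using int_\<zeta> \<zeta>_mean by (simp add: Bochner_Integration.integral_sum)
      have intL2: "integrable M (\<lambda>\<omega>. (L \<omega>)\<^sup>2)" using gaussian_variable_integrable[OF gL] by simp
      have intkL: "integrable M (\<lambda>\<omega>. L \<omega> * \<eta> k \<omega>)"
        unfolding L_def using int_\<zeta>\<eta> by (simp add: sum_distrib_right mult.assoc)
      have oL: "expectation (\<lambda>\<omega>. L \<omega> * \<eta> k \<omega>) = 0"
        unfolding L_def using int_\<zeta>\<eta> orth
        by (simp add: sum_distrib_right mult.assoc Bochner_Integration.integral_sum)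
      have intk2: "integrable M (\<lambda>\<omega>. (s * \<eta> k \<omega>)\<^sup>2)" using gaussian_variable_integrable[OF gk] by simp
      \<comment> \<open>The cross term vanishes by \<open>oL\<close>, so the second moments add and
        the Gaussian characteristic functions multiply.\<close>
      have "expectation (\<lambda>\<omega>. (s * \<eta> k \<omega> + L \<omega>)\<^sup>2)
          = expectation (\<lambda>\<omega>. (s * \<eta> k \<omega>)\<^sup>2 + (L \<omega>)\<^sup>2 + 2 * s * (L \<omega> * \<eta> k \<omega>))"
        by (rule Bochner_Integration.integral_cong) (auto simp: power2_eq_square algebra_simps)
      also have "\<dots> = expectation (\<lambda>\<omega>. (s * \<eta> k \<omega>)\<^sup>2) + expectation (\<lambda>\<omega>. (L \<omega>)\<^sup>2)"
        using intk2 intL2 intkL oL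
        by (simp add: Bochner_Integration.integral_add)
      finally have var: "expectation (\<lambda>\<omega>. (s * \<eta> k \<omega> + L \<omega>)\<^sup>2)
          = expectation (\<lambda>\<omega>. (s * \<eta> k \<omega>)\<^sup>2) + expectation (\<lambda>\<omega>. (L \<omega>)\<^sup>2)" .
      have "(CLINT \<omega>|M. iexp (s * \<eta> k \<omega>) * iexp (L \<omega>)) = (CLINT \<omega>|M. iexp (s * \<eta> k \<omega> + L \<omega>))"
        by (simp only: of_real_add distrib_left exp_add)
      also have "\<dots> = of_real (exp (- expectation (\<lambda>\<omega>. (s * \<eta> k \<omega> + L \<omega>)\<^sup>2) / 2))"
        by (rule iexp_centered_gaussian[OF gkL]) (use int mean intL mL in simp)
      also have "\<dots> = of_real (exp (- expectation (\<lambda>\<omega>. (s * \<eta> k \<omega>)\<^sup>2) / 2))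
          * of_real (exp (- expectation (\<lambda>\<omega>. (L \<omega>)\<^sup>2) / 2))"
        unfolding var of_real_mult[symmetric] exp_add[symmetric] by (simp add: add_divide_distrib)
      also have "\<dots> = (CLINT \<omega>|M. iexp (s * \<eta> k \<omega>)) * (CLINT \<omega>|M. iexp (L \<omega>))"
        using iexp_centered_gaussian[OF gL mL] iexp_centered_gaussian[OF gk] mean[of k] by simp
      finally show "(CLINT \<omega>|M. iexp (s * \<eta> k \<omega>) * iexp (\<Sum>j\<in>J. l j * \<zeta> j \<omega>))
        = (CLINT \<omega>|M. iexp (s * \<eta> k \<omega>)) * (CLINT \<omega>|M. iexp (\<Sum>j\<in>J. l j * \<zeta> j \<omega>))"
        unfolding L_def .
    qed auto
    note joint = this
    let ?P = "distr M borel (\<eta> k)" and ?Q = "distr M (PiM UNIV (\<lambda>_. borel)) (\<lambda>\<omega> i. \<zeta> i \<omega>)"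
    interpret P: prob_space ?P by (rule prob_space_distr) simp
    interpret Q: prob_space ?Q by (rule prob_space_distr) simp
    interpret PQ: pair_sigma_finite ?P ?Q ..
    have P: "?P = density lborel ?\<phi>"
      using normal(2) by (simp add: distributed_def cong: distr_cong)
    \<comment> \<open>\<open>T\<close> rebuilds the vector from the value \<open>x\<close> of
      \<open>\<eta> k\<close> and the residuals \<open>z\<close>; for fixed \<open>z\<close> it runs
      along a line.\<close>
    define T where "T x z = (\<lambda>i. z i + x * b i)" for x :: real and z :: "'i \<Rightarrow> real"
    have T_meas [measurable]: "(\<lambda>(x, z). T x z) \<in> measurable (borel \<Otimes>\<^sub>M PiM UNIV (\<lambda>_. borel)) (PiM UNIV (\<lambda>_. borel))"
      unfolding T_def split_beta' by (rule measurable_PiM_single') auto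
    have T\<eta>: "T (\<eta> k \<omega>) (\<lambda>i. \<zeta> i \<omega>) = (\<lambda>i. \<eta> i \<omega>)" for \<omega>
      by (auto simp: T_def \<zeta>_def)
    have fubini: "expectation (\<lambda>\<omega>. h (\<eta> k \<omega>) (\<lambda>i. \<zeta> i \<omega>)) = (\<integral>z. (\<integral>x. ?\<phi> x * h x z \<partial>lborel) \<partial>?Q)"
      if h [measurable]: "case_prod h \<in> borel_measurable (borel \<Otimes>\<^sub>M PiM UNIV (\<lambda>_. borel))"
        and ih: "integrable M (\<lambda>\<omega>. h (\<eta> k \<omega>) (\<lambda>i. \<zeta> i \<omega>))" for h :: "real \<Rightarrow> ('i \<Rightarrow> real) \<Rightarrow> real"
    proof -
      have "integrable (distr M (borel \<Otimes>\<^sub>M PiM UNIV (\<lambda>_. borel)) (\<lambda>\<omega>. (\<eta> k \<omega>, \<lambda>i. \<zeta> i \<omega>))) (case_prod h)"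
        by (subst integrable_distr_eq) (use ih in auto)
      hence "(\<integral>z. (\<integral>x. h x z \<partial>?P) \<partial>?Q) = integral\<^sup>L (?P \<Otimes>\<^sub>M ?Q) (case_prod h)"
        unfolding joint[symmetric] by (rule PQ.integral_snd)
      also have "\<dots> = expectation (\<lambda>\<omega>. h (\<eta> k \<omega>) (\<lambda>i. \<zeta> i \<omega>))"
        unfolding joint by (subst integral_distr) auto
      also have "(\<integral>z. (\<integral>x. h x z \<partial>?P) \<partial>?Q) = (\<integral>z. (\<integral>x. ?\<phi> x * h x z \<partial>lborel) \<partial>?Q)"
      proof (rule Bochner_Integration.integral_cong[OF refl])
        fix z
        have "(\<lambda>x. case_prod h (x, z)) \<in> borel_measurable borel"
          by (rule measurable_compose[OF measurable_Pair2' h]) (simp add: space_PiM)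
        hence "(\<lambda>x. h x z) \<in> borel_measurable borel" by simp
        thus "(\<integral>x. h x z \<partial>?P) = (\<integral>x. ?\<phi> x * h x z \<partial>lborel)"
          unfolding P by (subst integral_density) auto
      qed
      finally show ?thesis by simp
    qed
    have "expectation (\<lambda>\<omega>. \<eta> k \<omega> * F (\<lambda>i. \<eta> i \<omega>))
        = expectation (\<lambda>\<omega>. \<eta> k \<omega> * F (T (\<eta> k \<omega>) (\<lambda>i. \<zeta> i \<omega>)))" by (simp only: T\<eta>)
    also have "\<dots> = (\<integral>z. (\<integral>x. ?\<phi> x * (x * F (T x z)) \<partial>lborel) \<partial>?Q)"
    proof (rule fubini)
      show "integrable M (\<lambda>\<omega>. \<eta> k \<omega> * F (T (\<eta> k \<omega>) (\<lambda>i. \<zeta> i \<omega>)))"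
        unfolding T\<eta>
      proof (rule Bochner_Integration.integrable_bound)
        show "integrable M (\<lambda>\<omega>. \<eta> k \<omega> * C)" using int by simp
        show "AE \<omega> in M. norm (\<eta> k \<omega> * F (\<lambda>i. \<eta> i \<omega>)) \<le> norm (\<eta> k \<omega> * C)"
        proof (rule AE_I2)
          fix \<omega>
          have "\<bar>F (\<lambda>i. \<eta> i \<omega>)\<bar> \<le> \<bar>C\<bar>" using bdd(1)[of "\<lambda>i. \<eta> i \<omega>"] by linarith
          thus "norm (\<eta> k \<omega> * F (\<lambda>i. \<eta> i \<omega>)) \<le> norm (\<eta> k \<omega> * C)"
            by (simp add: abs_mult mult_left_mono)
        qed
      qed measurable
    qed measurable
    also have "\<dots> = (\<integral>z. (\<integral>x. ?\<phi> x * F' (T x z) \<partial>lborel) \<partial>?Q)"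
    proof (rule Bochner_Integration.integral_cong[OF refl])
      fix z
      have [measurable]: "(\<lambda>x. T x z) \<in> measurable borel (PiM UNIV (\<lambda>_. borel))"
        unfolding T_def by (rule measurable_PiM_single') auto
      \<comment> \<open>Along \<open>x\<close> the point \<open>T x z\<close> moves with velocity
        \<open>b = c / \<sigma>^2\<close>, whereas \<open>deriv\<close> is stated for velocity
        \<open>c\<close>. The derivative therefore carries a factor \<open>1 / \<sigma>^2\<close>,
        which cancels the variance produced by the one-dimensional formula.\<close>
      have "(\<integral>x. ?\<phi> x * (x * F (T x z)) \<partial>lborel) = \<sigma>\<^sup>2 * (\<integral>x. ?\<phi> x * (F' (T x z) / \<sigma>\<^sup>2) \<partial>lborel)"
      proof (rule normal_density_integration_by_parts[where C = "max C (C / \<sigma>\<^sup>2)", OF normal(1)])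
        fix x
        have 1: "((\<lambda>y. (y - x) / \<sigma>\<^sup>2) has_real_derivative 1 / \<sigma>\<^sup>2) (at x)"
          by (rule DERIV_cong[OF DERIV_cdivide[OF DERIV_diff[OF DERIV_ident DERIV_const]]]) simp
        have 2: "((\<lambda>r. F (\<lambda>i. T x z i + r * c i)) has_real_derivative F' (T x z)) (at ((x - x) / \<sigma>\<^sup>2))"
          using deriv[of "T x z"] by (simp add: c_def)
        have "((\<lambda>r. F (\<lambda>i. T x z i + r * c i)) \<circ> (\<lambda>y. (y - x) / \<sigma>\<^sup>2) has_real_derivative F' (T x z) * (1 / \<sigma>\<^sup>2)) (at x)"
          by (rule DERIV_chain[OF 2 1])
        moreover have "(\<lambda>r. F (\<lambda>i. T x z i + r * c i)) \<circ> (\<lambda>y. (y - x) / \<sigma>\<^sup>2) = (\<lambda>y. F (T y z))"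
          using normal(1) by (auto simp: T_def b_def ck o_def field_simps intro!: ext arg_cong[where f=F])
        ultimately show "((\<lambda>y. F (T y z)) has_real_derivative F' (T x z) / \<sigma>\<^sup>2) (at x)" by simp
        show "\<bar>F (T x z)\<bar> \<le> max C (C / \<sigma>\<^sup>2)" using bdd(1)[of "T x z"] by simp
        have "\<bar>F' (T x z) / \<sigma>\<^sup>2\<bar> \<le> C / \<sigma>\<^sup>2"
          using bdd(2)[of "T x z"] by (simp add: divide_right_mono)
        thus "\<bar>F' (T x z) / \<sigma>\<^sup>2\<bar> \<le> max C (C / \<sigma>\<^sup>2)" by simp
      qed measurable
      also have "\<dots> = (\<integral>x. ?\<phi> x * F' (T x z) \<partial>lborel)"
        using normal(1) by (subst integral_mult_right_zero[symmetric]) simp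
      finally show "(\<integral>x. ?\<phi> x * (x * F (T x z)) \<partial>lborel) = (\<integral>x. ?\<phi> x * F' (T x z) \<partial>lborel)" .
    qed
    also have "\<dots> = expectation (\<lambda>\<omega>. F' (T (\<eta> k \<omega>) (\<lambda>i. \<zeta> i \<omega>)))"
    proof (rule fubini[symmetric])
      show "integrable M (\<lambda>\<omega>. F' (T (\<eta> k \<omega>) (\<lambda>i. \<zeta> i \<omega>)))"
        unfolding T\<eta> by (rule integrable_const_bound[where B=C]) (use bdd in auto)
    qed measurable
    also have "\<dots> = expectation (\<lambda>\<omega>. F' (\<lambda>i. \<eta> i \<omega>))" by (simp only: T\<eta>)
    finally show ?thesis .
  qed
qed

section \<open>The implicit Euler scheme\<close>

text \<open>The positive root of \<open>y = a + c / y\<close>.\<close>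

definition euler_step :: "real \<Rightarrow> real \<Rightarrow> real" where
  "euler_step c a = (a + sqrt (a\<^sup>2 + 4 * c)) / 2"

primrec euler :: "real \<Rightarrow> real \<Rightarrow> (nat \<Rightarrow> real) \<Rightarrow> nat \<Rightarrow> real" where
  "euler c x0 v 0 = x0"
| "euler c x0 v (Suc k) = euler_step c (euler c x0 v k + v k)"

definition euler_step_deriv :: "real \<Rightarrow> real \<Rightarrow> real" where
  "euler_step_deriv c a = (1 + a / sqrt (a\<^sup>2 + 4 * c)) / 2"

text \<open>The chain rule applied to the recursion, for noise moving from \<open>v\<close> in the
  direction \<open>w\<close>; it starts at 0 because the initial value does not move.\<close>

primrec euler_tangent :: "real \<Rightarrow> real \<Rightarrow> (nat \<Rightarrow> real) \<Rightarrow> (nat \<Rightarrow> real) \<Rightarrow> nat \<Rightarrow> real" where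
  "euler_tangent c x0 w v 0 = 0"
| "euler_tangent c x0 w v (Suc k)
    = euler_step_deriv c (euler c x0 v k + v k) * (euler_tangent c x0 w v k + w k)"

lemma abs_less_sqrt_add:
  fixes a c :: real
  assumes "c > 0"
  shows "\<bar>a\<bar> < sqrt (a\<^sup>2 + 4 * c)"
  using assms by (intro real_less_rsqrt) simp

lemma euler_step_pos: "c > 0 \<Longrightarrow> euler_step c a > 0"
  using abs_less_sqrt_add[of c a] by (simp add: euler_step_def)

lemma euler_step_eq:
  assumes "c > 0"
  shows "euler_step c a = a + c / euler_step c a"
proof -
  let ?s = "sqrt (a\<^sup>2 + 4 * c)"
  have "?s\<^sup>2 = a\<^sup>2 + 4 * c" using assms by simp
  hence "euler_step c a * euler_step c a = a * euler_step c a + c"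
    unfolding euler_step_def by (simp add: power2_eq_square field_simps)
  thus ?thesis using euler_step_pos[OF assms, of a] by (simp add: field_simps)
qed

lemma euler_step_deriv:
  assumes "c > 0"
  shows "(euler_step c has_real_derivative euler_step_deriv c a) (at a)"
proof -
  have "a\<^sup>2 + 4 * c > 0" using assms by (simp add: add_nonneg_pos)
  thus ?thesis
    unfolding euler_step_def euler_step_deriv_def
    by (auto intro!: derivative_eq_intros simp: field_simps)
qed

lemma euler_step_deriv_bounds:
  assumes "c > 0"
  shows "0 \<le> euler_step_deriv c a" "euler_step_deriv c a \<le> 1"
proof -
  have *: "\<bar>a\<bar> < sqrt (a\<^sup>2 + 4 * c)" using assms by (rule abs_less_sqrt_add)
  hence "0 < sqrt (a\<^sup>2 + 4 * c)" by linarith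
  with * have "- 1 \<le> a / sqrt (a\<^sup>2 + 4 * c)" "a / sqrt (a\<^sup>2 + 4 * c) \<le> 1"
    by (simp_all only: pos_le_divide_eq pos_divide_le_eq)
  thus "0 \<le> euler_step_deriv c a" "euler_step_deriv c a \<le> 1"
    unfolding euler_step_deriv_def by simp_all
qed

lemma euler_pos: "c > 0 \<Longrightarrow> x0 > 0 \<Longrightarrow> euler c x0 v n > 0"
  by (cases n) (auto simp: euler_step_pos)

lemma euler_has_derivative:
  assumes "c > 0"
  shows "((\<lambda>x. euler c x0 (\<lambda>i. v i + x * w i) n) has_real_derivative euler_tangent c x0 w v n) (at 0)"
proof (induction n)
  case (Suc n)
  have "((\<lambda>x. euler c x0 (\<lambda>i. v i + x * w i) n + (v n + x * w n)) has_real_derivative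
      euler_tangent c x0 w v n + w n) (at 0)"
    by (rule derivative_eq_intros Suc refl | simp)+
  moreover have "(euler_step c has_real_derivative euler_step_deriv c (euler c x0 v n + v n))
      (at (euler c x0 (\<lambda>i. v i + 0 * w i) n + (v n + 0 * w n)))"
    using euler_step_deriv[OF assms] by simp
  ultimately show ?case
    using DERIV_chain2 by fastforce
qed simp

text \<open>Each step adds \<open>w n\<close> and multiplies by a factor in [0,1], so a nonnegative
  perturbation keeps its sign and never exceeds what was put in. With \<open>w\<close> the
  covariances with one increment, the upper bound at \<open>Suc k\<close> is the sum of covariances
  \<open>S\<close>.\<close>

lemma euler_tangent_bounds:
  assumes "c > 0" and "\<And>i. i < n \<Longrightarrow> 0 \<le> w i"
  shows "0 \<le> euler_tangent c x0 w v n \<and> euler_tangent c x0 w v n \<le> (\<Sum>i<n. w i)"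
  using assms(2)
proof (induction n)
  case (Suc n)
  let ?d = "euler_step_deriv c (euler c x0 v n + v n)"
  have IH: "0 \<le> euler_tangent c x0 w v n" "euler_tangent c x0 w v n \<le> (\<Sum>i<n. w i)"
    using Suc by auto
  have w: "0 \<le> w n" using Suc.prems by simp
  have "?d * (euler_tangent c x0 w v n + w n) \<le> 1 * (euler_tangent c x0 w v n + w n)"
    using IH w euler_step_deriv_bounds[OF assms(1)] by (intro mult_right_mono) auto
  thus ?case using IH w euler_step_deriv_bounds[OF assms(1)] by simp
qed simp

lemma measurable_euler [measurable]:
  "(\<lambda>v. euler c x0 v n) \<in> borel_measurable (PiM UNIV (\<lambda>_. borel))"
  by (induction n) (simp_all add: euler_step_def)

lemma measurable_euler_tangent [measurable]:
  "(\<lambda>v. euler_tangent c x0 w v n) \<in> borel_measurable (PiM UNIV (\<lambda>_. borel))"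
  by (induction n) (simp_all add: euler_step_deriv_def)

text \<open>Since \<open>c / x\<close> decreases in \<open>x\<close>, the difference of the two
  drifts always opposes the difference of the two values. Errors therefore only add up: there is no
  Gronwall factor, and no constant depending on how close the values come to the singularity at
  0.\<close>

lemma euler_stability:
  assumes c: "c > 0" and x0: "x 0 = x0" "x0 > 0" and pos: "\<And>k. k < n \<Longrightarrow> x (Suc k) > 0"
    and rec: "\<And>k. k < n \<Longrightarrow> x (Suc k) = x k + v k + c / x (Suc k) + r k"
  shows "\<bar>x n - euler c x0 v n\<bar> \<le> (\<Sum>k<n. \<bar>r k\<bar>)"
  using pos rec
proof (induction n)
  case 0
  thus ?case using x0 by simp
next
  case (Suc n)
  let ?y = "euler c x0 v"
  have IH: "\<bar>x n - ?y n\<bar> \<le> (\<Sum>k<n. \<bar>r k\<bar>)" using Suc by simp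
  have y: "?y (Suc n) = ?y n + v n + c / ?y (Suc n)"
    using euler_step_eq[OF c, of "?y n + v n"] by simp
  have y0: "?y (Suc n) > 0" by (rule euler_pos[OF c x0(2)])
  have xr: "x (Suc n) = x n + v n + c / x (Suc n) + r n" and xp: "x (Suc n) > 0" using Suc.prems by auto
  have "\<bar>x (Suc n) - ?y (Suc n)\<bar> \<le> \<bar>x n - ?y n + r n\<bar>"
  proof (cases "x (Suc n) \<ge> ?y (Suc n)")
    case True
    hence "c / x (Suc n) \<le> c / ?y (Suc n)" using c y0 by (intro divide_left_mono) auto
    thus ?thesis using True xr y by linarith
  next
    case False
    hence "c / ?y (Suc n) \<le> c / x (Suc n)" using c xp by (intro divide_left_mono) auto
    thus ?thesis using False xr y by linarith
  qed
  also have "\<dots> \<le> (\<Sum>k<Suc n. \<bar>r k\<bar>)" using IH by simp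
  finally show ?case .
qed

text \<open>The tangent at \<open>b\<close> lies below the graph of the convex function
  \<open>x powr (- p)\<close>. It follows from \<open>1 + u \<le> exp u\<close> at
  \<open>u = - p * ln (a / b)\<close> together with \<open>ln y \<le> y - 1\<close>.\<close>

lemma powr_neg_diff_le:
  fixes a b p :: real
  assumes "a > 0" "b > 0" "p \<ge> 0"
  shows "b powr (- p) - a powr (- p) \<le> - p * b powr (- p - 1) * (b - a)"
proof -
  have "1 + (- p * ln (a / b)) \<le> exp (- p * ln (a / b))" by (rule exp_ge_add_one_self)
  also have "\<dots> = a powr (- p) / b powr (- p)"
    using assms by (simp add: powr_def ln_div algebra_simps flip: exp_diff)
  finally have "1 - p * ln (a / b) \<le> a powr (- p) / b powr (- p)" by simp
  moreover have "p * ln (a / b) \<le> p * (a / b - 1)"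
    using assms by (intro mult_left_mono ln_le_minus_one) auto
  ultimately have "1 - p * (a / b - 1) \<le> a powr (- p) / b powr (- p)" by linarith
  hence "b powr (- p) * (1 - p * (a / b - 1)) \<le> a powr (- p)"
    using assms by (simp add: field_simps)
  moreover have "b powr (- p) * (1 - p * (a / b - 1)) = b powr (- p) + p * (b powr (- p) / b) * (b - a)"
    using assms by (simp add: field_simps)
  moreover have "b powr (- p - 1) = b powr (- p) / b"
    using assms by (simp add: powr_diff)
  ultimately show ?thesis by simp
qed

lemma (in prob_space) expectation_euler_powr_step:
  fixes \<eta> :: "nat \<Rightarrow> 'a \<Rightarrow> real"
  assumes \<eta>: "gaussian_process M UNIV \<eta>" and mean: "\<And>i. expectation (\<eta> i) = 0"
    and cov: "\<And>i. i \<le> k \<Longrightarrow> 0 \<le> expectation (\<lambda>\<omega>. \<eta> i \<omega> * \<eta> k \<omega>)"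
    and c: "c > 0" and x0: "x0 > 0" and \<epsilon>: "\<epsilon> > 0" and p: "p \<ge> 0"
    and sum_cov: "(p + 1) * (\<Sum>i\<le>k. expectation (\<lambda>\<omega>. \<eta> i \<omega> * \<eta> k \<omega>)) \<le> c"
  shows "expectation (\<lambda>\<omega>. (euler c x0 (\<lambda>i. \<eta> i \<omega>) (Suc k) + \<epsilon>) powr (- p))
    \<le> expectation (\<lambda>\<omega>. (euler c x0 (\<lambda>i. \<eta> i \<omega>) k + \<epsilon>) powr (- p))"
proof -
  define w where "w i = expectation (\<lambda>\<omega>. \<eta> i \<omega> * \<eta> k \<omega>)" for i
  define S where "S = (\<Sum>i\<le>k. w i)"
  have gv: "gaussian_variable M (\<eta> i)" for i using gaussian_processD[OF \<eta>] by simp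
  have [measurable]: "random_variable borel (\<eta> i)" for i
    using gv by (auto simp: gaussian_variable_def)
  have int: "integrable M (\<eta> i)" for i using gaussian_variable_integrable[OF gv] by simp
  have \<eta>_PiM [measurable]: "(\<lambda>\<omega> i. \<eta> i \<omega>) \<in> measurable M (PiM UNIV (\<lambda>_. borel))"
    by (rule measurable_PiM_single') auto
  let ?Y = "\<lambda>v. euler c x0 v (Suc k)" and ?T = "\<lambda>v. euler_tangent c x0 w v (Suc k)"
  have Y0: "euler c x0 v n > 0" for v n by (rule euler_pos[OF c x0])
  have Ye: "0 < euler c x0 v n + \<epsilon>" for v n using Y0[of v n] \<epsilon> by simp
  have T: "0 \<le> ?T v" "?T v \<le> S" for v
    using euler_tangent_bounds[OF c, of "Suc k" w x0 v] cov
    by (auto simp: w_def S_def lessThan_Suc_atMost simp del: euler_tangent.simps)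
  have powr_bd: "\<bar>(euler c x0 v n + \<epsilon>) powr (- q)\<bar> \<le> \<epsilon> powr (- q)" if "q \<ge> 0" for q v n
    using Y0[of v n] \<epsilon> that by (auto intro!: powr_mono2')
  have powr_int: "integrable M (\<lambda>\<omega>. (euler c x0 (\<lambda>i. \<eta> i \<omega>) n + \<epsilon>) powr (- q))" if "q \<ge> 0" for q n
    by (rule integrable_const_bound[where B="\<epsilon> powr (- q)"]) (use powr_bd[OF that] in auto)
  define F where "F v = (?Y v + \<epsilon>) powr (- (p + 1))" for v
  define G where "G v = (?Y v + \<epsilon>) powr (- (p + 2))" for v
  \<comment> \<open>The derivative of \<open>F\<close> along the covariance vector \<open>w\<close>:
    differentiation lowers the exponent to \<open>- (p + 2)\<close>, the one carried by the drift
    term, so noise and drift are compared through the same \<open>G\<close>.\<close>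
  define F' where "F' v = - (p + 1) * G v * ?T v" for v
  have G0: "G v \<ge> 0" for v by (simp add: G_def)
  have intG: "integrable M (\<lambda>\<omega>. G (\<lambda>i. \<eta> i \<omega>))" unfolding G_def by (rule powr_int) (use p in auto)
  have F'G: "- ((p + 1) * S) * G v \<le> F' v" "F' v \<le> 0" for v
  proof -
    have "((p + 1) * G v) * ?T v \<le> ((p + 1) * G v) * S"
      using T p G0 by (intro mult_left_mono) auto
    thus "- ((p + 1) * S) * G v \<le> F' v" unfolding F'_def by (simp add: algebra_simps del: euler_tangent.simps)
    show "F' v \<le> 0" unfolding F'_def
      by (intro mult_nonpos_nonneg) (use T(1)[of v] p G0[of v] in \<open>simp_all del: euler_tangent.simps\<close>)
  qed
  have S0: "S \<ge> 0" using T[of "\<lambda>_. 0"] by linarith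
  have [measurable]: "F \<in> borel_measurable (PiM UNIV (\<lambda>_. borel))"
    "F' \<in> borel_measurable (PiM UNIV (\<lambda>_. borel))"
    unfolding F_def F'_def G_def by measurable
  have F'_bd: "\<bar>F' v\<bar> \<le> (p + 1) * S * \<epsilon> powr (- (p + 2))" for v
  proof -
    have "\<bar>F' v\<bar> \<le> (p + 1) * S * G v" using F'G[of v] by simp
    also have "\<dots> \<le> (p + 1) * S * \<epsilon> powr (- (p + 2))"
      using powr_bd[of "p + 2" v "Suc k"] p S0 by (intro mult_left_mono) (auto simp: G_def)
    finally show ?thesis .
  qed
  have IBP: "expectation (\<lambda>\<omega>. \<eta> k \<omega> * F (\<lambda>i. \<eta> i \<omega>)) = expectation (\<lambda>\<omega>. F' (\<lambda>i. \<eta> i \<omega>))"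
  proof (rule gaussian_integration_by_parts[OF \<eta> mean,
        where C = "max (\<epsilon> powr (- (p + 1))) ((p + 1) * S * \<epsilon> powr (- (p + 2)))"])
    fix v
    show "\<bar>F v\<bar> \<le> max (\<epsilon> powr (- (p + 1))) ((p + 1) * S * \<epsilon> powr (- (p + 2)))"
      using powr_bd[of "p + 1" v "Suc k"] p by (simp add: F_def del: euler.simps)
    show "\<bar>F' v\<bar> \<le> max (\<epsilon> powr (- (p + 1))) ((p + 1) * S * \<epsilon> powr (- (p + 2)))"
      using F'_bd[of v] by simp
    have "((\<lambda>x. ?Y (\<lambda>i. v i + x * w i) + \<epsilon>) has_real_derivative ?T v) (at 0)"
      using DERIV_add[OF euler_has_derivative[OF c, of x0 v w "Suc k"] DERIV_const[of \<epsilon>]] by simp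
    hence "((\<lambda>x. (?Y (\<lambda>i. v i + x * w i) + \<epsilon>) powr (- (p + 1))) has_real_derivative
        (- (p + 1)) * (?Y (\<lambda>i. v i + 0 * w i) + \<epsilon>) powr (- (p + 1) - of_nat 1) * ?T v) (at 0)"
      by (rule DERIV_fun_powr) (rule Ye)
    moreover have "- (p + 1) - of_nat 1 = - (p + 2)" by simp
    ultimately show "((\<lambda>x. F (\<lambda>i. v i + x * expectation (\<lambda>\<omega>. \<eta> i \<omega> * \<eta> k \<omega>))) has_real_derivative F' v) (at 0)"
      unfolding F_def F'_def G_def w_def[symmetric]
      by (simp only: mult_zero_left add_0_right)
  qed measurable
  have int_\<eta>F: "integrable M (\<lambda>\<omega>. \<eta> k \<omega> * F (\<lambda>i. \<eta> i \<omega>))"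
  proof (rule Bochner_Integration.integrable_bound)
    show "integrable M (\<lambda>\<omega>. \<eta> k \<omega> * \<epsilon> powr (- (p + 1)))" using int by simp
    show "AE \<omega> in M. norm (\<eta> k \<omega> * F (\<lambda>i. \<eta> i \<omega>)) \<le> norm (\<eta> k \<omega> * \<epsilon> powr (- (p + 1)))"
      using powr_bd[of "p + 1" _ "Suc k"] p
      by (intro AE_I2) (simp add: abs_mult F_def mult_left_mono del: euler.simps)
  qed measurable
  have intF': "integrable M (\<lambda>\<omega>. F' (\<lambda>i. \<eta> i \<omega>))"
    by (rule integrable_const_bound[where B="(p + 1) * S * \<epsilon> powr (- (p + 2))"]) (use F'_bd in auto)
  have ptw: "(?Y v + \<epsilon>) powr (- p) - (euler c x0 v k + \<epsilon>) powr (- p) \<le> - p * (v k * F v) - p * c * G v" for v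
  proof -
    let ?a = "euler c x0 v k + \<epsilon>" and ?b = "?Y v + \<epsilon>"
    have F: "F v = ?b powr (- p - 1)" by (simp add: F_def)
    have "- (p + 2) = (- p - 1) - 1" by simp
    hence GF: "G v = F v / ?b"
      unfolding F G_def using Ye[of v "Suc k"] by (simp only: powr_diff powr_one[OF less_imp_le])
    have "?b - ?a = v k + c / ?Y v"
      using euler_step_eq[OF c, of "euler c x0 v k + v k"] by simp
    \<comment> \<open>The scheme has the drift \<open>c / Y'\<close> without shift. Replacing it by
      the smaller \<open>c / (Y' + \<epsilon>)\<close> is harmless, as it multiplies the nonpositive
      \<open>- p * F v\<close>, and it produces exactly \<open>c * G v\<close>.\<close>
    moreover have "c / ?b \<le> c / ?Y v"
      using Y0[of v "Suc k"] \<epsilon> c by (intro divide_left_mono mult_pos_pos add_pos_pos) auto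
    ultimately have "?b - ?a \<ge> v k + c / ?b" by linarith
    hence "- p * F v * (?b - ?a) \<le> - p * F v * (v k + c / ?b)"
      using p by (intro mult_left_mono_neg) (auto simp: F mult_nonneg_nonneg)
    moreover have "?b powr (- p) - ?a powr (- p) \<le> - p * F v * (?b - ?a)"
      unfolding F by (rule powr_neg_diff_le[OF Ye Ye p])
    moreover have "- p * F v * (v k + c / ?b) = - p * (v k * F v) - p * c * G v"
      by (simp add: GF algebra_simps del: euler.simps)
    ultimately show ?thesis by linarith
  qed
  have "expectation (\<lambda>\<omega>. (?Y (\<lambda>i. \<eta> i \<omega>) + \<epsilon>) powr (- p)) - expectation (\<lambda>\<omega>. (euler c x0 (\<lambda>i. \<eta> i \<omega>) k + \<epsilon>) powr (- p))
      = expectation (\<lambda>\<omega>. (?Y (\<lambda>i. \<eta> i \<omega>) + \<epsilon>) powr (- p) - (euler c x0 (\<lambda>i. \<eta> i \<omega>) k + \<epsilon>) powr (- p))"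
    by (rule Bochner_Integration.integral_diff[symmetric]) (rule powr_int[OF p])+
  also have "\<dots> \<le> expectation (\<lambda>\<omega>. - p * (\<eta> k \<omega> * F (\<lambda>i. \<eta> i \<omega>)) - p * c * G (\<lambda>i. \<eta> i \<omega>))"
  proof (rule integral_mono)
    show "integrable M (\<lambda>\<omega>. (?Y (\<lambda>i. \<eta> i \<omega>) + \<epsilon>) powr (- p) - (euler c x0 (\<lambda>i. \<eta> i \<omega>) k + \<epsilon>) powr (- p))"
      by (rule Bochner_Integration.integrable_diff) (rule powr_int[OF p])+
    show "integrable M (\<lambda>\<omega>. - p * (\<eta> k \<omega> * F (\<lambda>i. \<eta> i \<omega>)) - p * c * G (\<lambda>i. \<eta> i \<omega>))"
      using int_\<eta>F intG by simp
  qed (rule ptw)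
  also have "\<dots> = - p * expectation (\<lambda>\<omega>. F' (\<lambda>i. \<eta> i \<omega>)) - p * c * expectation (\<lambda>\<omega>. G (\<lambda>i. \<eta> i \<omega>))"
    using int_\<eta>F intG IBP by simp
  \<comment> \<open>The factor \<open>- p\<close> reverses the lower bound on \<open>F'\<close>;
    what remains is \<open>G\<close> times a constant whose sign is decided by
    \<open>sum_cov\<close>.\<close>
  also have "\<dots> \<le> - p * expectation (\<lambda>\<omega>. - ((p + 1) * S) * G (\<lambda>i. \<eta> i \<omega>)) - p * c * expectation (\<lambda>\<omega>. G (\<lambda>i. \<eta> i \<omega>))"
    using p intG intF' F'G by (intro diff_right_mono mult_left_mono_neg integral_mono) auto
  also have "\<dots> = p * ((p + 1) * S - c) * expectation (\<lambda>\<omega>. G (\<lambda>i. \<eta> i \<omega>))"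
    by (simp only: integral_mult_right_zero) (simp add: algebra_simps)
  also have "\<dots> \<le> 0"
    using p sum_cov G0 by (intro mult_nonpos_nonneg mult_nonneg_nonpos integral_nonneg) (auto simp: S_def w_def)
  finally show ?thesis by simp
qed

section \<open>Pathwise convergence\<close>

text \<open>The solution, sampled on the grid, obeys the scheme up to small residuals, and
  \<open>euler_stability\<close> bounds the final error by their sum. Positivity is needed only
  along the fixed path: by compactness it bounds \<open>1 / X\<close> and makes \<open>K / X\<close>
  uniformly continuous. The drift constant may vary with \<open>n\<close>, as the application
  requires.\<close>

lemma euler_tendsto:
  fixes X b :: "real \<Rightarrow> real" and \<kappa> :: "nat \<Rightarrow> real"
  assumes t: "t > 0" and K: "K > 0" and x0: "x0 > 0"
    and pos: "\<And>s. s \<in> {0..t} \<Longrightarrow> X s > 0"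
    and int: "set_integrable lborel {0..t} (\<lambda>s. K / X s)"
    and eq: "\<And>s. s \<in> {0..t} \<Longrightarrow> X s = x0 + (LBINT u:{0..s}. K / X u) + b s"
    and b: "continuous_on {0..t} b" "b 0 = 0"
    and \<kappa>: "\<kappa> \<longlonglongrightarrow> K" "\<And>n. \<kappa> n > 0"
    and h: "\<And>n. h n = t / real (Suc n)"
  shows "(\<lambda>n. euler (\<kappa> n * h n) x0 (\<lambda>k. b (real (Suc k) * h n) - b (real k * h n)) (Suc n)) \<longlonglongrightarrow> X t"
proof -
  define g where "g s = K / X s" for s
  have g_int: "g integrable_on {0..t}"
    using set_borel_integral_eq_integral(1)[OF int] by (simp add: g_def[abs_def])
  have X_eq: "X s = x0 + integral {0..s} g + b s" if "s \<in> {0..t}" for s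
  proof -
    have "set_integrable lborel {0..s} (\<lambda>s. K / X s)"
      by (rule set_integrable_subset[OF int]) (use that in auto)
    thus ?thesis using eq[OF that] set_borel_integral_eq_integral(2) by (simp add: g_def[abs_def])
  qed
  have "continuous_on {0..t} (\<lambda>s. x0 + integral {0..s} g + b s)"
    by (intro continuous_intros indefinite_integral_continuous_1 g_int b)
  hence X_cont: "continuous_on {0..t} X" by (rule continuous_on_eq) (simp add: X_eq)
  have g_cont: "continuous_on {0..t} g"
    unfolding g_def using pos by (intro continuous_intros X_cont) (auto simp: less_imp_neq[symmetric])
  have X0: "X 0 = x0" using X_eq[of 0] b t by simp
  have "continuous_on {0..t} (\<lambda>s. 1 / X s)"
    using pos by (intro continuous_intros X_cont) (auto simp: less_imp_neq[symmetric])
  hence "bounded ((\<lambda>s. 1 / X s) ` {0..t})"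
    by (intro compact_imp_bounded compact_continuous_image) auto
  then obtain L where L: "L > 0" "\<And>s. s \<in> {0..t} \<Longrightarrow> \<bar>1 / X s\<bar> \<le> L"
    unfolding bounded_pos by auto
  have h0: "h n > 0" for n using t by (simp add: h)
  have hN: "real (Suc n) * h n = t" for n using h[of n] by (simp del: of_nat_Suc)
  \<comment> \<open>Each residual is at most \<open>h n\<close> times the oscillation of
    \<open>g\<close> over one cell plus the error from \<open>\<kappa> n\<close>. The cell lengths
    add up to \<open>t\<close>, so the number of steps disappears.\<close>
  have error: "\<bar>X t - euler (\<kappa> n * h n) x0 (\<lambda>k. b (real (Suc k) * h n) - b (real k * h n)) (Suc n)\<bar>
      \<le> t * (e + \<bar>\<kappa> n - K\<bar> * L)"
    if mod: "\<And>s u. s \<in> {0..t} \<Longrightarrow> u \<in> {0..t} \<Longrightarrow> \<bar>s - u\<bar> \<le> h n \<Longrightarrow> \<bar>g s - g u\<bar> \<le> e" and e: "e \<ge> 0" for n e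
  proof -
    define \<tau> where "\<tau> k = real k * h n" for k
    have \<tau>: "\<tau> k \<in> {0..t}" if "k \<le> Suc n" for k
      using that h0[of n] mult_right_mono[of "real k" "real (Suc n)" "h n"]
      unfolding \<tau>_def by (simp add: hN[of n, symmetric] del: of_nat_Suc)
    have \<tau>_Suc: "\<tau> (Suc k) = \<tau> k + h n" for k by (simp add: \<tau>_def algebra_simps)
    define v where "v k = b (\<tau> (Suc k)) - b (\<tau> k)" for k
    \<comment> \<open>The residual compares the integrated drift with the drift at the right
      endpoint of the cell, matching the implicit step.\<close>
    define r where "r k = X (\<tau> (Suc k)) - X (\<tau> k) - v k - \<kappa> n * h n / X (\<tau> (Suc k))" for k
    have r: "\<bar>r k\<bar> \<le> (e + \<bar>\<kappa> n - K\<bar> * L) * h n" if k: "k < Suc n" for k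
    proof -
      have k1: "\<tau> k \<in> {0..t}" "\<tau> (Suc k) \<in> {0..t}" using \<tau>[of k] \<tau>[of "Suc k"] k by auto
      define d where "d = \<kappa> n / X (\<tau> (Suc k))"
      have gi: "g integrable_on {\<tau> k..\<tau> (Suc k)}" "g integrable_on {0..\<tau> (Suc k)}"
        by (rule integrable_on_subinterval[OF g_int]; use k1 in force)+
      have "integral {0..\<tau> k} g + integral {\<tau> k..\<tau> (Suc k)} g = integral {0..\<tau> (Suc k)} g"
        by (rule Henstock_Kurzweil_Integration.integral_combine) (use k1 gi h0[of n] in \<open>auto simp: \<tau>_Suc\<close>)
      hence "r k = integral {\<tau> k..\<tau> (Suc k)} g - h n * d"
        unfolding r_def d_def v_def using X_eq[OF k1(1)] X_eq[OF k1(2)] by (simp add: mult.commute)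
      hence "((\<lambda>s. g s - d) has_integral r k) {\<tau> k..\<tau> (Suc k)}"
        using has_integral_diff[OF integrable_integral[OF gi(1)] has_integral_const_real[of d "\<tau> k" "\<tau> (Suc k)"]]
          h0[of n] by (simp add: \<tau>_Suc)
      hence "norm (r k) \<le> (e + \<bar>\<kappa> n - K\<bar> * L) * measure lborel {\<tau> k..\<tau> (Suc k)}"
      proof (rule has_integral_bound_real[where S = "{}", rotated 2])
        show "0 \<le> e + \<bar>\<kappa> n - K\<bar> * L" using e L by simp
        fix s assume "s \<in> {\<tau> k..\<tau> (Suc k)} - {}"
        hence s: "s \<in> {0..t}" "\<bar>s - \<tau> (Suc k)\<bar> \<le> h n" using k1 by (auto simp: \<tau>_Suc)
        have "g s - d = (g s - g (\<tau> (Suc k))) - (\<kappa> n - K) * (1 / X (\<tau> (Suc k)))"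
          by (simp add: g_def d_def diff_divide_distrib)
        hence "\<bar>g s - d\<bar> \<le> \<bar>g s - g (\<tau> (Suc k))\<bar> + \<bar>\<kappa> n - K\<bar> * \<bar>1 / X (\<tau> (Suc k))\<bar>"
          by (simp only: abs_mult[symmetric] abs_triangle_ineq4)
        also have "\<dots> \<le> e + \<bar>\<kappa> n - K\<bar> * L"
          by (intro add_mono mult_left_mono mod s k1 L) auto
        finally show "norm (g s - d) \<le> e + \<bar>\<kappa> n - K\<bar> * L" by simp
      qed simp
      thus ?thesis using h0[of n] by (simp add: \<tau>_Suc)
    qed
    have "\<bar>X (\<tau> (Suc n)) - euler (\<kappa> n * h n) x0 v (Suc n)\<bar> \<le> (\<Sum>k<Suc n. \<bar>r k\<bar>)"
    proof (rule euler_stability)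
      show "X (\<tau> 0) = x0" using X0 by (simp add: \<tau>_def)
      show "X (\<tau> (Suc k)) > 0" if "k < Suc n" for k using that by (intro pos \<tau>) simp
    qed (use \<kappa>(2)[of n] h0[of n] x0 in \<open>auto simp: r_def\<close>)
    also have "\<dots> \<le> (\<Sum>k<Suc n. (e + \<bar>\<kappa> n - K\<bar> * L) * h n)"
      by (intro sum_mono r) simp
    also have "\<dots> = real (Suc n) * h n * (e + \<bar>\<kappa> n - K\<bar> * L)" by simp
    also have "\<dots> = t * (e + \<bar>\<kappa> n - K\<bar> * L)" unfolding hN ..
    finally show ?thesis
      unfolding v_def[abs_def] \<tau>_def hN .
  qed
  have h_lim: "h \<longlonglongrightarrow> 0"
    using LIMSEQ_Suc[OF lim_const_over_n[of t]] by (simp add: h[abs_def])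
  have \<kappa>_lim: "(\<lambda>n. t * (\<bar>\<kappa> n - K\<bar> * L)) \<longlonglongrightarrow> 0"
    using \<kappa>(1) by (intro tendsto_mult_right_zero tendsto_mult_left_zero) (simp add: tendsto_rabs_zero_iff LIM_zero_iff)
  show ?thesis
  proof (rule LIMSEQ_I)
    fix e :: real assume e: "e > 0"
    have "uniformly_continuous_on {0..t} g"
      by (rule compact_uniformly_continuous[OF g_cont]) simp
    then obtain \<delta> where \<delta>: "\<delta> > 0"
      "\<And>s u. s \<in> {0..t} \<Longrightarrow> u \<in> {0..t} \<Longrightarrow> dist s u < \<delta> \<Longrightarrow> dist (g s) (g u) < e / (2 * t)"
      unfolding uniformly_continuous_on_def using e t by (metis divide_pos_pos mult_pos_pos zero_less_numeral)
    have "\<forall>\<^sub>F n in sequentially. h n < \<delta>" using order_tendstoD(2)[OF h_lim \<delta>(1)] .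
    moreover have "\<forall>\<^sub>F n in sequentially. t * (\<bar>\<kappa> n - K\<bar> * L) < e / 2"
      using order_tendstoD(2)[OF \<kappa>_lim, of "e / 2"] e by simp
    ultimately have "\<forall>\<^sub>F n in sequentially. norm (euler (\<kappa> n * h n) x0 (\<lambda>k. b (real (Suc k) * h n) - b (real k * h n)) (Suc n) - X t) < e"
    proof eventually_elim
      case (elim n)
      have "\<bar>X t - euler (\<kappa> n * h n) x0 (\<lambda>k. b (real (Suc k) * h n) - b (real k * h n)) (Suc n)\<bar>
          \<le> t * (e / (2 * t) + \<bar>\<kappa> n - K\<bar> * L)"
      proof (rule error)
        fix s u assume "s \<in> {0..t}" "u \<in> {0..t}" "\<bar>s - u\<bar> \<le> h n"
        thus "\<bar>g s - g u\<bar> \<le> e / (2 * t)" using \<delta>(2)[of s u] elim by (simp add: dist_real_def)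
      qed (use e t in simp)
      also have "\<dots> = e / 2 + t * (\<bar>\<kappa> n - K\<bar> * L)" using t by (simp add: distrib_left)
      also have "\<dots> < e" using elim by simp
      finally show ?case by (simp add: abs_minus_commute)
    qed
    thus "\<exists>no. \<forall>n\<ge>no. norm (euler (\<kappa> n * h n) x0 (\<lambda>k. b (real (Suc k) * h n) - b (real k * h n)) (Suc n) - X t) < e"
      by (simp add: eventually_sequentially)
  qed
qed

section \<open>Fractional Brownian motion\<close>

text \<open>Mean value theorem, with the intermediate point raised to \<open>b\<close> because
  \<open>\<alpha> - 1\<close> is nonnegative. For \<open>\<alpha> = 2 * H\<close> this is the source
  of the factor \<open>H\<close> in the critical time.\<close>

lemma powr_diff_le:
  fixes a b \<alpha> :: real
  assumes "0 \<le> a" "a \<le> b" "1 \<le> \<alpha>"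
  shows "b powr \<alpha> - a powr \<alpha> \<le> \<alpha> * b powr (\<alpha> - 1) * (b - a)"
proof (cases "a = b")
  case False
  hence ab: "a < b" using assms by simp
  obtain z where z: "a < z" "z < b" "b powr \<alpha> - a powr \<alpha> = \<alpha> * z powr (\<alpha> - 1) * (b - a)"
  proof (rule mvt[OF ab, of "\<lambda>x. x powr \<alpha>" "\<lambda>x. (*) (\<alpha> * x powr (\<alpha> - 1))"])
    show "continuous_on {a..b} (\<lambda>x. x powr \<alpha>)"
      using assms by (intro continuous_on_powr' continuous_intros) auto
    fix x assume "a < x" "x < b"
    hence "((\<lambda>x. x powr \<alpha>) has_real_derivative \<alpha> * x powr (\<alpha> - 1)) (at x)"
      using assms by (intro has_real_derivative_powr) auto
    thus "((\<lambda>x. x powr \<alpha>) has_derivative ((*) (\<alpha> * x powr (\<alpha> - 1)))) (at x)"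
      by (simp add: has_field_derivative_def)
  qed auto
  have "\<alpha> * z powr (\<alpha> - 1) * (b - a) \<le> \<alpha> * b powr (\<alpha> - 1) * (b - a)"
    using z assms by (intro mult_right_mono mult_left_mono powr_mono2) auto
  thus ?thesis using z(3) by simp
qed simp

text \<open>Midpoint convexity of \<open>x powr \<alpha>\<close>. At \<open>d = h\<close> the left
  point is 0, and the claim becomes \<open>2 \<le> 2 powr \<alpha>\<close> up to scaling. With
  \<open>\<alpha> = 2 * H\<close> it says that disjoint increments are nonnegatively
  correlated.\<close>

lemma powr_second_difference_nonneg:
  fixes d h \<alpha> :: real
  assumes "1 \<le> \<alpha>" "0 \<le> h" "h \<le> d"
  shows "2 * d powr \<alpha> \<le> (d - h) powr \<alpha> + (d + h) powr \<alpha>"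
proof (cases "d = h")
  case True
  have "2 * h powr \<alpha> \<le> 2 powr \<alpha> * h powr \<alpha>"
    using assms powr_mono[of 1 \<alpha> 2] by (intro mult_right_mono) auto
  thus ?thesis using True assms by (simp add: powr_mult flip: mult_2)
next
  case False
  hence "h < d" using assms by simp
  hence "((1 - 1/2) *\<^sub>R (d - h) + (1/2) *\<^sub>R (d + h)) powr \<alpha>
      \<le> (1 - 1/2) * (d - h) powr \<alpha> + (1/2) * (d + h) powr \<alpha>"
    using assms by (intro convex_onD[OF powr_convex]) auto
  moreover have "(1 - 1/2) *\<^sub>R (d - h) + (1/2) *\<^sub>R (d + h) = d" by (simp add: field_simps)
  ultimately show ?thesis by simp
qed

lemma (in prob_space) fBm_increment_cov:
  assumes B: "fractional_brownian_motion M H B"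
    and nonneg: "0 \<le> s" "0 \<le> s'" "0 \<le> u" "0 \<le> u'"
  shows "integrable M (\<lambda>\<omega>. (B s' \<omega> - B s \<omega>) * (B u' \<omega> - B u \<omega>))"
    and "expectation (\<lambda>\<omega>. (B s' \<omega> - B s \<omega>) * (B u' \<omega> - B u \<omega>))
      = (\<bar>s' - u\<bar> powr (2 * H) + \<bar>s - u'\<bar> powr (2 * H)
          - \<bar>s' - u'\<bar> powr (2 * H) - \<bar>s - u\<bar> powr (2 * H)) / 2"
proof -
  have gp: "gaussian_process M {0..} B"
    and cov: "\<And>s t. 0 \<le> s \<Longrightarrow> 0 \<le> t \<Longrightarrow> expectation (\<lambda>\<omega>. B s \<omega> * B t \<omega>)
        = (s powr (2 * H) + t powr (2 * H) - \<bar>s - t\<bar> powr (2 * H)) / 2"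
    using B by (auto simp: fractional_brownian_motion_def)
  have int: "integrable M (\<lambda>\<omega>. B s \<omega> * B t \<omega>)" if "0 \<le> s" "0 \<le> t" for s t
    using gaussian_process_integrable_mult[OF gp] that by simp
  have eq: "(B s' \<omega> - B s \<omega>) * (B u' \<omega> - B u \<omega>)
      = B s' \<omega> * B u' \<omega> - B s' \<omega> * B u \<omega> - B s \<omega> * B u' \<omega> + B s \<omega> * B u \<omega>" for \<omega>
    by (simp add: algebra_simps)
  show "integrable M (\<lambda>\<omega>. (B s' \<omega> - B s \<omega>) * (B u' \<omega> - B u \<omega>))"
    unfolding eq using int nonneg by simp
  show "expectation (\<lambda>\<omega>. (B s' \<omega> - B s \<omega>) * (B u' \<omega> - B u \<omega>))
      = (\<bar>s' - u\<bar> powr (2 * H) + \<bar>s - u'\<bar> powr (2 * H)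
          - \<bar>s' - u'\<bar> powr (2 * H) - \<bar>s - u\<bar> powr (2 * H)) / 2"
    unfolding eq using int nonneg by (simp add: cov field_simps)
qed

lemma gaussian_process_increments:
  assumes B: "gaussian_process M {0..} B" and h: "h > 0"
  shows "gaussian_process M UNIV (\<lambda>k \<omega>. B (real (Suc k) * h) \<omega> - B (real k * h) \<omega>)"
proof -
  \<comment> \<open>As \<open>h > 0\<close> the two grid points differ, so the set has two elements
    and the coefficient can be chosen by testing for the left endpoint.\<close>
  define I where "I k = {real (Suc k) * h, real k * h}" for k
  have "gaussian_process M UNIV (\<lambda>k \<omega>. \<Sum>s\<in>I k. (if s = real k * h then - 1 else 1) * B s \<omega>)"
    using h by (intro gaussian_process_linear[OF B]) (auto simp: I_def)
  moreover have "(\<Sum>s\<in>I k. (if s = real k * h then - 1 else 1) * B s \<omega>)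
      = B (real (Suc k) * h) \<omega> - B (real k * h) \<omega>" for k \<omega>
    using h by (simp add: I_def)
  ultimately show ?thesis by simp
qed

lemma (in prob_space) fBm_zero_AE:
  assumes "fractional_brownian_motion M H B"
  shows "AE \<omega> in M. B 0 \<omega> = 0"
proof -
  have g: "gaussian_variable M (B 0)"
    using assms by (auto simp: fractional_brownian_motion_def intro!: gaussian_processD)
  have "expectation (\<lambda>\<omega>. B 0 \<omega> * B 0 \<omega>) = 0"
    using assms by (auto simp: fractional_brownian_motion_def)
  thus ?thesis
    using integral_nonneg_eq_0_iff_AE[OF gaussian_variable_integrable(2)[OF g]]
    by (simp add: power2_eq_square)
qed

text \<open>The drift constant is increased from \<open>K\<close> to \<open>\<kappa>\<close> in order to absorb the variance
  \<open>h powr (2 * H)\<close> of a single increment; this vanishes in the limit, and it allows \<open>t\<close> to be the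
  critical time itself.\<close>

lemma (in prob_space) expectation_euler_fBm:
  assumes B: "fractional_brownian_motion M H B"
    and H: "1 / 2 < H" and K: "K > 0" and x0: "x0 > 0" and p: "p \<ge> 1" and \<epsilon>: "\<epsilon> > 0"
    and h: "h > 0" and N: "(real N * h) powr (2 * H - 1) \<le> K / ((p + 1) * H)"
  defines "\<kappa> \<equiv> K + (p + 1) / 2 * h powr (2 * H - 1)"
  shows "expectation (\<lambda>\<omega>. (euler (\<kappa> * h) x0
      (\<lambda>k. B (real (Suc k) * h) \<omega> - B (real k * h) \<omega>) N + \<epsilon>) powr (- p)) \<le> x0 powr (- p)"
proof -
  define \<eta> where "\<eta> k \<omega> = B (real (Suc k) * h) \<omega> - B (real k * h) \<omega>" for k \<omega>
  have gp: "gaussian_process M {0..} B" and mean: "\<And>t. 0 \<le> t \<Longrightarrow> expectation (B t) = 0"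
    using B by (auto simp: fractional_brownian_motion_def)
  have \<eta>: "gaussian_process M UNIV \<eta>"
    using gaussian_process_increments[OF gp h] by (simp add: \<eta>_def[abs_def])
  have intB: "integrable M (B s)" if "0 \<le> s" for s
    using gaussian_variable_integrable(1)[OF gaussian_processD[OF gp]] that by simp
  have \<eta>_mean: "expectation (\<eta> k) = 0" for k
    unfolding \<eta>_def using h by (simp add: intB mean)
  have \<kappa>: "\<kappa> * h > 0" using K h p by (simp add: \<kappa>_def add_pos_nonneg)
  have cov: "0 \<le> expectation (\<lambda>\<omega>. \<eta> i \<omega> * \<eta> k \<omega>)" if "i \<le> k" for i k
  proof -
    \<comment> \<open>The covariance depends only on the lag \<open>d\<close>: it is half the second
      difference of \<open>x powr (2 * H)\<close> at \<open>d\<close> with step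
      \<open>h\<close>.\<close>
    define d where "d = real (k - i) * h"
    have d: "d \<ge> 0" using h by (simp add: d_def)
    have diff: "real (Suc i) * h - real k * h = h - d" "real i * h - real (Suc k) * h = - d - h"
      "real (Suc i) * h - real (Suc k) * h = - d" "real i * h - real k * h = - d"
      using that by (simp_all add: d_def of_nat_diff algebra_simps)
    have "expectation (\<lambda>\<omega>. \<eta> i \<omega> * \<eta> k \<omega>)
      = (\<bar>h - d\<bar> powr (2 * H) + \<bar>- d - h\<bar> powr (2 * H) - \<bar>- d\<bar> powr (2 * H) - \<bar>- d\<bar> powr (2 * H)) / 2"
      using fBm_increment_cov(2)[OF B, of "real i * h" "real (Suc i) * h" "real k * h" "real (Suc k) * h"] h
      unfolding \<eta>_def diff by simp
    also have "\<dots> = (\<bar>d - h\<bar> powr (2 * H) + (d + h) powr (2 * H) - 2 * d powr (2 * H)) / 2"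
      using d h by (simp add: abs_minus_commute add.commute)
    also have "\<dots> \<ge> 0"
    \<comment> \<open>The diagonal needs its own case because
      \<open>powr_second_difference_nonneg\<close> assumes \<open>h \<le> d\<close>; here
      \<open>d = 0\<close> and the expression is a variance.\<close>
    proof (cases "k = i")
      case True
      thus ?thesis by (simp add: d_def)
    next
      case False
      hence "1 * h \<le> d" unfolding d_def using that h by (intro mult_right_mono) auto
      thus ?thesis using powr_second_difference_nonneg[of "2 * H" h d] H h by simp
    qed
    finally show ?thesis .
  qed
  have sum_cov: "(p + 1) * (\<Sum>i\<le>k. expectation (\<lambda>\<omega>. \<eta> i \<omega> * \<eta> k \<omega>)) \<le> \<kappa> * h" if k: "k < N" for k
  proof -
    define s where "s = real (Suc k) * h"
    have s: "0 < s" "s \<le> real N * h" "real k * h = s - h"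
    proof -
      show "0 < s" unfolding s_def using h by (intro mult_pos_pos) auto
      show "s \<le> real N * h" unfolding s_def using h k by (intro mult_right_mono) auto
      show "real k * h = s - h" unfolding s_def by (simp add: algebra_simps)
    qed
    have s1: "0 \<le> s - h" using s(3) h by (metis mult_nonneg_nonneg of_nat_0_le_iff less_imp_le)
    have \<eta>k: "\<eta> k \<omega> = B s \<omega> - B (s - h) \<omega>" for \<omega>
      unfolding \<eta>_def s(3) s_def[symmetric] ..
    \<comment> \<open>The sum runs up to and including \<open>k\<close>, so it ends at the right
      endpoint \<open>s\<close> of the current cell, and the sum of covariances becomes one
      covariance between two increments.\<close>
    have tele: "(\<Sum>i\<le>k. \<eta> i \<omega>) = B s \<omega> - B 0 \<omega>" for \<omega>
      unfolding \<eta>_def s_def lessThan_Suc_atMost[symmetric]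
      by (subst sum_lessThan_telescope) simp
    have "(\<Sum>i\<le>k. expectation (\<lambda>\<omega>. \<eta> i \<omega> * \<eta> k \<omega>)) = expectation (\<lambda>\<omega>. \<Sum>i\<le>k. \<eta> i \<omega> * \<eta> k \<omega>)"
      by (rule Bochner_Integration.integral_sum[symmetric])
        (rule gaussian_process_integrable_mult[OF \<eta>]; simp)
    also have "\<dots> = expectation (\<lambda>\<omega>. (B s \<omega> - B 0 \<omega>) * (B s \<omega> - B (s - h) \<omega>))"
      unfolding sum_distrib_right[symmetric] tele \<eta>k ..
    also have "\<dots> = (h powr (2 * H) + (s powr (2 * H) - (s - h) powr (2 * H))) / 2"
      using s s1 h by (subst fBm_increment_cov(2)[OF B]) auto
    also have "\<dots> \<le> (h powr (2 * H) + 2 * H * s powr (2 * H - 1) * h) / 2"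
      using powr_diff_le[of "s - h" s "2 * H"] s1 h H by simp
    also have "\<dots> \<le> (h powr (2 * H) + 2 * H * (K / ((p + 1) * H)) * h) / 2"
    proof -
      have "s powr (2 * H - 1) \<le> (real N * h) powr (2 * H - 1)"
        using s H by (intro powr_mono2) auto
      also note N
      finally have "2 * H * s powr (2 * H - 1) * h \<le> 2 * H * (K / ((p + 1) * H)) * h"
        using H h by (intro mult_right_mono mult_left_mono) auto
      thus ?thesis by (rule divide_right_mono[OF add_left_mono]) simp
    qed
    \<comment> \<open>This identity dictates the correction in \<open>\<kappa>\<close>: divided by
      \<open>p + 1\<close>, the extra \<open>(p + 1) / 2 * h powr (2 * H - 1) * h\<close> is the
      leftover \<open>h powr (2 * H) / 2\<close>.\<close>
    also have "\<dots> = \<kappa> * h / (p + 1)"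
    proof -
      have 1: "h powr (2 * H) = h powr (2 * H - 1) * h" using h by (simp add: powr_diff)
      have 2: "2 * H * (K / ((p + 1) * H)) = 2 * K / (p + 1)" using H by simp
      have "p + 1 \<noteq> 0" using p by simp
      thus ?thesis unfolding 1 2 \<kappa>_def by (simp add: field_simps)
    qed
    finally show ?thesis using p by (simp add: field_simps)
  qed
  \<comment> \<open>Induction over the steps with \<open>h\<close> and \<open>\<kappa>\<close>
    fixed; at step 0 the shift by \<open>\<epsilon>\<close> can only decrease the negative
    power.\<close>
  have "expectation (\<lambda>\<omega>. (euler (\<kappa> * h) x0 (\<lambda>k. \<eta> k \<omega>) n + \<epsilon>) powr (- p)) \<le> x0 powr (- p)" if "n \<le> N" for n
    using that
  proof (induction n)
    case 0
    have "(x0 + \<epsilon>) powr (- p) \<le> x0 powr (- p)"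
      using x0 \<epsilon> p by (intro powr_mono2') auto
    thus ?case by (simp add: prob_space)
  next
    case (Suc n)
    have "expectation (\<lambda>\<omega>. (euler (\<kappa> * h) x0 (\<lambda>k. \<eta> k \<omega>) (Suc n) + \<epsilon>) powr (- p))
        \<le> expectation (\<lambda>\<omega>. (euler (\<kappa> * h) x0 (\<lambda>k. \<eta> k \<omega>) n + \<epsilon>) powr (- p))"
      using Suc.prems p by (intro expectation_euler_powr_step \<eta> \<eta>_mean cov \<kappa> x0 \<epsilon> sum_cov) auto
    also have "\<dots> \<le> x0 powr (- p)" using Suc by simp
    finally show ?case .
  qed
  thus ?thesis unfolding \<eta>_def by simp
qed

theorem proposition3p4:
  fixes M :: "'a measure" and B X :: "real \<Rightarrow> 'a \<Rightarrow> real" and H x0 K p t :: real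
  assumes "prob_space M"
    and "1 / 2 < H" and "H < 1"
    and "fractional_brownian_motion M H B"
    and "x0 > 0" and "K > 0"
    and "positive_solution M B K x0 X"
    and "p \<ge> 1"
    and "0 \<le> t" and "t \<le> (K / ((p + 1) * H)) powr (1 / (2 * H - 1))"
  shows "integrable M (\<lambda>\<omega>. X t \<omega> powr (- p)) \<and>
         (\<integral>\<omega>. X t \<omega> powr (- p) \<partial>M) \<le> x0 powr (- p)"
proof -
  interpret prob_space M by fact
  note H = assms(2) and fBm = assms(4) and x0 = assms(5) and K = assms(6) and p = assms(8)
  have sol: "AE \<omega> in M. \<forall>t\<ge>0. X t \<omega> > 0 \<and>
        set_integrable lborel {0..t} (\<lambda>s. K / X s \<omega>) \<and>
        X t \<omega> = x0 + (LBINT s:{0..t}. K / X s \<omega>) + B t \<omega>"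
    and Xt [measurable]: "random_variable borel (X t)"
    using assms(7,9) by (auto simp: positive_solution_def)
  have B0: "AE \<omega> in M. B 0 \<omega> = 0" by (rule fBm_zero_AE[OF fBm])
  have cont: "AE \<omega> in M. continuous_on {0..} (\<lambda>t. B t \<omega>)"
    and gp: "gaussian_process M {0..} B"
    using fBm by (auto simp: fractional_brownian_motion_def)
  have B_meas [measurable]: "random_variable borel (B s)" if "0 \<le> s" for s
    using gaussian_processD[OF gp, of s] that by (simp add: gaussian_variable_def)
  \<comment> \<open>Integrability is not known beforehand, so the bound is proved for the
    nonnegative integral, whose finiteness then yields it.\<close>
  have "(\<integral>\<^sup>+\<omega>. ennreal (X t \<omega> powr (- p)) \<partial>M) \<le> ennreal (x0 powr (- p))"
  \<comment> \<open>At time 0 the mesh \<open>t / real (Suc n)\<close> would degenerate; there the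
    equation gives \<open>X 0 = x0\<close> almost surely.\<close>
  proof (cases "t = 0")
    case True
    have "AE \<omega> in M. X t \<omega> = x0"
      using sol B0
    proof eventually_elim
      case (elim \<omega>)
      have "X 0 \<omega> = x0 + (LBINT s:{0..0}. K / X s \<omega>) + B 0 \<omega>" using elim(1) by blast
      moreover have "(LBINT s:{0..0}. K / X s \<omega>) = 0"
        using set_borel_integral_eq_integral(2)[of "{0..0}" "\<lambda>s. K / X s \<omega>"] elim(1) by simp
      ultimately show ?case using elim(2) True by simp
    qed
    hence "(\<integral>\<^sup>+\<omega>. ennreal (X t \<omega> powr (- p)) \<partial>M) = (\<integral>\<^sup>+\<omega>. ennreal (x0 powr (- p)) \<partial>M)"
      by (intro nn_integral_cong_AE) auto
    thus ?thesis by (simp add: emeasure_space_1)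
  next
    case False
    hence t: "t > 0" using assms(9) by simp
    define h where "h n = t / real (Suc n)" for n
    define \<kappa> where "\<kappa> n = K + (p + 1) / 2 * h n powr (2 * H - 1)" for n
    \<comment> \<open>Since the bound for the scheme is the same for every shift, the shift may
      vanish along the same index as the mesh, and one limit suffices.\<close>
    define \<epsilon> where "\<epsilon> n = 1 / real (Suc n)" for n
    define Y where "Y n \<omega> = euler (\<kappa> n * h n) x0
      (\<lambda>k. B (real (Suc k) * h n) \<omega> - B (real k * h n) \<omega>) (Suc n) + \<epsilon> n" for n \<omega>
    have h0: "h n > 0" and \<epsilon>0: "\<epsilon> n > 0" and hN: "real (Suc n) * h n = t" for n
      using t by (simp_all add: h_def \<epsilon>_def)
    have \<kappa>0: "\<kappa> n > 0" for n using K p by (simp add: \<kappa>_def add_pos_nonneg)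
    have h_lim: "h \<longlonglongrightarrow> 0"
      using LIMSEQ_Suc[OF lim_const_over_n[of t]] by (simp add: h_def[abs_def])
    \<comment> \<open>The correction to the drift constant vanishes because the exponent
      \<open>2 * H - 1\<close> is positive.\<close>
    have "(\<lambda>n. h n powr (2 * H - 1)) \<longlonglongrightarrow> 0 powr (2 * H - 1)"
      using h_lim H h0 by (intro tendsto_powr') (auto intro!: always_eventually less_imp_le)
    hence "(\<lambda>n. K + (p + 1) / 2 * h n powr (2 * H - 1)) \<longlonglongrightarrow> K + (p + 1) / 2 * 0"
      by (intro tendsto_intros) simp
    hence \<kappa>_lim: "\<kappa> \<longlonglongrightarrow> K" by (simp add: \<kappa>_def[abs_def])
    have \<epsilon>_lim: "\<epsilon> \<longlonglongrightarrow> 0"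
      using LIMSEQ_Suc[OF lim_const_over_n[of 1]] by (simp add: \<epsilon>_def[abs_def])
    have t_bound: "t powr (2 * H - 1) \<le> K / ((p + 1) * H)"
    proof -
      have "t powr (2 * H - 1) \<le> ((K / ((p + 1) * H)) powr (1 / (2 * H - 1))) powr (2 * H - 1)"
        using assms(9,10) H by (intro powr_mono2) auto
      also have "\<dots> = K / ((p + 1) * H)"
        using H K p by (simp add: powr_powr)
      finally show ?thesis .
    qed
    have Y_meas [measurable]: "random_variable borel (Y n)" for n
    proof -
      have "(\<lambda>\<omega> k. B (real (Suc k) * h n) \<omega> - B (real k * h n) \<omega>) \<in> measurable M (PiM UNIV (\<lambda>_. borel))"
        using h0[of n] by (intro measurable_PiM_single') (auto intro!: borel_measurable_diff B_meas)
      from measurable_compose[OF this measurable_euler] show ?thesis unfolding Y_def by measurable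
    qed
    have Y_pos: "\<epsilon> n \<le> Y n \<omega>" for n \<omega>
      unfolding Y_def using euler_pos[of "\<kappa> n * h n" x0] \<kappa>0[of n] h0[of n] x0 by (simp del: euler.simps add: less_imp_le)
    have Y_int: "integrable M (\<lambda>\<omega>. Y n \<omega> powr (- p))" for n
    proof (rule integrable_const_bound[where B="\<epsilon> n powr (- p)"])
      show "AE \<omega> in M. norm (Y n \<omega> powr (- p)) \<le> \<epsilon> n powr (- p)"
        using Y_pos \<epsilon>0 p by (auto intro!: powr_mono2')
    qed measurable
    have Y_exp: "expectation (\<lambda>\<omega>. Y n \<omega> powr (- p)) \<le> x0 powr (- p)" for n
      unfolding Y_def \<kappa>_def
      by (rule expectation_euler_fBm[OF fBm H K x0 p \<epsilon>0 h0]) (simp only: hN t_bound)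
    have lim: "AE \<omega> in M. (\<lambda>n. ennreal (Y n \<omega> powr (- p))) \<longlonglongrightarrow> ennreal (X t \<omega> powr (- p))"
      using sol B0 cont
    proof eventually_elim
      case (elim \<omega>)
      have "(\<lambda>n. euler (\<kappa> n * h n) x0 (\<lambda>k. B (real (Suc k) * h n) \<omega> - B (real k * h n) \<omega>) (Suc n))
          \<longlonglongrightarrow> X t \<omega>"
      proof (rule euler_tendsto[where b = "\<lambda>s. B s \<omega>", OF t K x0])
        show "continuous_on {0..t} (\<lambda>s. B s \<omega>)"
          using elim(3) by (rule continuous_on_subset) auto
      qed (use elim(1,2) \<kappa>_lim \<kappa>0 t in \<open>auto simp: h_def\<close>)
      hence "(\<lambda>n. Y n \<omega>) \<longlonglongrightarrow> X t \<omega>"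
        using tendsto_add[OF _ \<epsilon>_lim] unfolding Y_def by fastforce
      moreover have "X t \<omega> > 0" using elim(1) assms(9) by blast
      ultimately show ?case by (intro tendsto_ennrealI tendsto_powr tendsto_const) auto
    qed
    \<comment> \<open>Fatou's lemma rather than dominated convergence: the only uniform bound on
      \<open>Y n\<close>, namely \<open>\<epsilon> n \<le> Y n\<close>, degenerates in the
      limit.\<close>
    have "(\<integral>\<^sup>+\<omega>. ennreal (X t \<omega> powr (- p)) \<partial>M) = (\<integral>\<^sup>+\<omega>. liminf (\<lambda>n. ennreal (Y n \<omega> powr (- p))) \<partial>M)"
      by (intro nn_integral_cong_AE, use lim in eventually_elim)
        (rule lim_imp_Liminf[OF sequentially_bot, symmetric])
    also have "\<dots> \<le> liminf (\<lambda>n. \<integral>\<^sup>+\<omega>. ennreal (Y n \<omega> powr (- p)) \<partial>M)"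
      by (rule nn_integral_liminf) measurable
    also have "\<dots> \<le> liminf (\<lambda>n. ennreal (x0 powr (- p)))"
      by (intro Liminf_mono always_eventually allI)
        (simp add: nn_integral_eq_integral[OF Y_int] ennreal_leI Y_exp)
    also have "\<dots> = ennreal (x0 powr (- p))" by (simp add: Liminf_const)
    finally show ?thesis .
  qed
  moreover from this have int: "integrable M (\<lambda>\<omega>. X t \<omega> powr (- p))"
    by (intro integrableI_nonneg) (auto intro: le_less_trans)
  ultimately show ?thesis
    by (simp add: nn_integral_eq_integral)
qed

end
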